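(* Consider the non-uniform Kuramoto model $$D_i\dot\theta_i=\omega_i-\sum_{j=1}^nP_{ij}\sin(\theta_i-\theta_j+\varphi_{ij}),\quad i\in\{1,\dots,n\},$$ where the graph induced by $P$ has a globally reachable node. Assume that there exists $\gamma\in[0,\pi/2-\varphi_{\max}[$ such that the (non-empty) set of bounded phase differences $\bar\Delta(\gamma)$ is positively invariant. Then for every $\theta(0)\in\bar\Delta(\gamma)$: 1) the frequencies $\dot\theta_i(t)$ synchronize exponentially to some frequency $\dot\theta_\infty\in[\dot\theta_{\min}(0),\dot\theta_{\max}(0)]$; and 2) if $\varphi_{\max}=0$ and $P=P^T$, then $\dot\theta_\infty=\Omega:=\sum_i\omega_i/\sum_iD_i$ and the exponential synchronization rate is no worse than $$\lambda_{\mathrm{fe}}=-\lambda_2(L(P_{ij}))\cos(\gamma)\cos(\angle(D\mathbf 1,\mathbf 1))^2/D_{\max},$$ i.e., $\|\dot\theta(t)-\Omega\mathbf 1\|_2\le C e^{\lambda_{\mathrm{fe}}t}$ for all $t\ge0$ and some constant $C$.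
   Context: Parameters: $D_i>0$, $\omega_i\in\mathbb R$, $P_{ij}\ge0$ (some $P_{ij}$ may be zero and $P$ need not be symmetric), $P_{ii}=0$, $\varphi_{ij}=\varphi_{ji}\in[0,\pi/2[$, $\varphi_{ii}=0$. $D=\mathrm{diag}(D_i)$, $D_{\max}=\max_iD_i$, $\varphi_{\max}=\max_{i,j}\varphi_{ij}$, $\dot\theta_{\min}(0)=\min_i\dot\theta_i(0)$, $\dot\theta_{\max}(0)=\max_i\dot\theta_i(0)$; $\mathbf 1\in\mathbb R^n$ is the vector of ones; $\angle(x,y)\in[0,\pi/2]$ is the angle between nonzero vectors, $\cos\angle(x,y)=x^Ty/(\|x\|\|y\|)$. The graph induced by a nonnegative matrix $P$ is the weighted directed graph on nodes $\{1,\dots,n\}$ with a directed edge $(i,j)$ of weight $P_{ij}$ whenever $P_{ij}>0$; a node is globally reachable if there is a directed path to it from every other node. $L(P_{ij})=\mathrm{diag}(\sum_jP_{ij})-P$ is the Laplacian and, for $P=P^T$, $\lambda_2$ denotes its second-smallest eigenvalue. Geometry: $\mathbb T^1=\,]-\pi,\pi]$ with $\pm\pi$ identified, $\mathbb T^n$ the $n$-torus. An arc is a connected subset of $\mathbb T^1$. For $\gamma\in[0,\pi]$, $\Delta(\gamma)\subset\mathbb T^n$ is the set of $(\theta_1,\dots,\theta_n)$ such that there exists an arc of length $\gamma$ containing all $\theta_i$ in its interior; $\bar\Delta(\gamma)$ is the union of $\{\theta:\theta_i=\theta_j\ \forall i,j\}$ and the closure of $\Delta(\gamma)$. "Synchronize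 exponentially to $\dot\theta_\infty$" means that every $\dot\theta_i(t)$ converges exponentially fast to the common value $\dot\theta_\infty\in\mathbb R$ as $t\to\infty$. *)

theory Defs
  imports "HOL-Analysis.Analysis"
begin

definition induced_edges :: "real^'n^'n \<Rightarrow> ('n \<times> 'n) set" where
  "induced_edges P = {(i, j). P $ i $ j > 0}"

definition globally_reachable :: "real^'n^'n \<Rightarrow> 'n \<Rightarrow> bool" where
  "globally_reachable P k \<longleftrightarrow> (\<forall>i. (i, k) \<in> (induced_edges P)\<^sup>*)"

definition diag_matrix :: "real^'n \<Rightarrow> real^'n^'n" where
  "diag_matrix d = (\<chi> i j. if i = j then d $ i else 0)"

definition laplacian :: "real^'n^'n \<Rightarrow> real^'n^'n" where
  "laplacian P = diag_matrix (\<chi> i. \<Sum>j\<in>UNIV. P $ i $ j) - P"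

definition eigenspace :: "real^'n^'n \<Rightarrow> real \<Rightarrow> (real^'n) set" where
  "eigenspace A x = {v. A *v v = x *\<^sub>R v}"

definition eigenvalues :: "real^'n^'n \<Rightarrow> real set" where
  "eigenvalues A = {x. \<exists>v. v \<noteq> 0 \<and> A *v v = x *\<^sub>R v}"

text \<open>
  Eigenvalues in increasing order, repeated according to multiplicity. Only symmetric matrices
  matter here, for which geometric and algebraic multiplicity agree. In dimension 1 there is no
  second eigenvalue and \<open>lambda2\<close> is an unspecified real number.
\<close>

definition eigenvalue_list :: "real^'n^'n \<Rightarrow> real list" where
  "eigenvalue_list A =
     concat (map (\<lambda>x. replicate (dim (eigenspace A x)) x) (sorted_list_of_set (eigenvalues A)))"

definition lambda2 :: "real^'n^'n \<Rightarrow> real" where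
  "lambda2 A = eigenvalue_list A ! 1"

definition vec_angle :: "real^'n \<Rightarrow> real^'n \<Rightarrow> real" where
  "vec_angle x y = arccos (x \<bullet> y / (norm x * norm y))"

definition vec_max :: "real^'n \<Rightarrow> real" where
  "vec_max x = Max (range (\<lambda>i. x $ i))"

definition vec_min :: "real^'n \<Rightarrow> real" where
  "vec_min x = Min (range (\<lambda>i. x $ i))"

definition mat_max :: "real^'n^'n \<Rightarrow> real" where
  "mat_max A = Max (range (\<lambda>(i, j). A $ i $ j))"

text \<open>
  The circle \<open>]-\<pi>, \<pi>]\<close> with \<open>\<pm>\<pi>\<close> identified is modelled as the complex unit circle, the
  angle \<open>t\<close> being the point \<open>cis t\<close>; the torus carries the resulting product topology.
\<close>

definition circle :: "complex set" where
  "circle = sphere 0 1"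

definition torus :: "(complex^'n) set" where
  "torus = {z. \<forall>i. z $ i \<in> circle}"

definition to_torus :: "real^'n \<Rightarrow> complex^'n" where
  "to_torus \<theta> = (\<chi> i. cis (\<theta> $ i))"

definition is_arc :: "complex set \<Rightarrow> bool" where
  "is_arc A \<longleftrightarrow> A \<subseteq> circle \<and> connected A"

definition arc_length :: "complex set \<Rightarrow> real" where
  "arc_length A = measure lebesgue {t \<in> {-pi<..pi}. cis t \<in> A}"

definition Delta :: "real \<Rightarrow> (complex^'n) set" where
  "Delta \<gamma> = {z \<in> torus. \<exists>A. is_arc A \<and> arc_length A = \<gamma> \<and>
                 (\<forall>i. z $ i \<in> top_of_set circle interior_of A)}"

text \<open>The torus is closed, so the ambient closure is the closure in the torus.\<close>

definition Delta_bar :: "real \<Rightarrow> (complex^'n) set" where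
  "Delta_bar \<gamma> = {z \<in> torus. \<forall>i j. z $ i = z $ j} \<union> closure (Delta \<gamma>)"

text \<open>
  Trajectories on the torus are represented by real-valued lifts \<open>\<theta>\<close>, and \<open>\<theta>'\<close> is the vector of
  frequencies (one-sided derivative at time 0).
\<close>

definition kuramoto_solution ::
  "real^'n \<Rightarrow> real^'n \<Rightarrow> real^'n^'n \<Rightarrow> real^'n^'n \<Rightarrow> (real \<Rightarrow> real^'n) \<Rightarrow> (real \<Rightarrow> real^'n) \<Rightarrow> bool"
where
  "kuramoto_solution D \<omega> P \<phi> \<theta> \<theta>' \<longleftrightarrow>
     (\<forall>t\<ge>0. (\<theta> has_vector_derivative \<theta>' t) (at t within {0..}) \<and>
        (\<forall>i. D $ i * \<theta>' t $ i =
              \<omega> $ i - (\<Sum>j\<in>UNIV. P $ i $ j * sin (\<theta> t $ i - \<theta> t $ j + \<phi> $ i $ j))))"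

definition positively_invariant ::
  "real^'n \<Rightarrow> real^'n \<Rightarrow> real^'n^'n \<Rightarrow> real^'n^'n \<Rightarrow> (complex^'n) set \<Rightarrow> bool"
where
  "positively_invariant D \<omega> P \<phi> S \<longleftrightarrow>
     (\<forall>\<theta> \<theta>'. kuramoto_solution D \<omega> P \<phi> \<theta> \<theta>' \<longrightarrow> to_torus (\<theta> 0) \<in> S \<longrightarrow>
        (\<forall>t\<ge>0. to_torus (\<theta> t) \<in> S))"

definition converges_exponentially :: "(real \<Rightarrow> real) \<Rightarrow> real \<Rightarrow> bool" where
  "converges_exponentially f l \<longleftrightarrow>
     (\<exists>C r. r > 0 \<and> (\<forall>t\<ge>0. \<bar>f t - l\<bar> \<le> C * exp (- r * t)))"

definition lambda_fe :: "real^'n \<Rightarrow> real^'n^'n \<Rightarrow> real \<Rightarrow> real" where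
  "lambda_fe D P \<gamma> =
     - lambda2 (laplacian P) * cos \<gamma> * (cos (vec_angle (diag_matrix D *v 1) 1))\<^sup>2 / vec_max D"

end

theory Submission
  imports Defs
begin

text \<open>
  Differentiating the model shows that the frequencies \<open>x = \<theta>'\<close> obey the linear, time-varying
  consensus dynamics
  \<open>x\<^sub>i' = \<Sum>\<^sub>j a\<^sub>i\<^sub>j(t) (x\<^sub>j - x\<^sub>i)\<close> with
  \<open>a\<^sub>i\<^sub>j(t) = P\<^sub>i\<^sub>j cos (\<theta>\<^sub>i - \<theta>\<^sub>j + \<phi>\<^sub>i\<^sub>j) / D\<^sub>i\<close>.
  Invariance keeps all phase differences within \<open>\<gamma>\<close> modulo \<open>2\<pi>\<close>
  (\<open>Delta_bar_phase_differences\<close>), so each cosine is at least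
  \<open>cos (\<gamma> + \<phi>\<^sub>m\<^sub>a\<^sub>x) > 0\<close> and the weights stay nonnegative, bounded, and bounded away
  from zero along the edges of the graph (\<open>kuramoto_consensus_flow\<close>).

  Under such dynamics the largest frequency never increases and the smallest never decreases. Within
  a fixed time the globally reachable node pulls all other nodes towards itself, and hence
  away from whichever extreme it is farther from. The spread therefore shrinks by a fixed
  factor over each such period (\<open>spread_contracts\<close>), which gives exponential convergence to a
  common value between the initial extremes (\<open>exponential_consensus\<close>).

  In the symmetric case without phase shifts, \<open>\<Sum>\<^sub>i D\<^sub>i x\<^sub>i = \<Sum>\<^sub>i \<omega>\<^sub>i\<close> at all times, as the
  coupling terms cancel in pairs; this determines the limit \<open>\<nu>\<close>. The energy
  \<open>W = \<Sum>\<^sub>i D\<^sub>i (x\<^sub>i - \<nu>)\<^sup>2\<close> satisfies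
  \<open>W' \<le> - 2 cos \<gamma> (x - \<nu> 1) \<bullet> L (x - \<nu> 1)\<close>. The variational description of \<open>\<lambda>\<^sub>2\<close> bounds the
  Laplacian form by the part of \<open>x - \<nu> 1\<close> orthogonal to \<open>1\<close>. As \<open>x - \<nu> 1\<close> itself is orthogonal
  to \<open>D 1\<close>, that part retains at least the fraction \<open>cos\<^sup>2\<close> of the angle between \<open>D 1\<close> and \<open>1\<close>
  of its squared norm (\<open>laplacian_gap_weighted_mean_zero\<close>). Gronwall's inequality then yields the
  rate (\<open>frequency_norm_decay\<close>).
\<close>

section \<open>Arcs of the circle and phase differences\<close>

text \<open>
  Two points removed from the circle cut it into two open arcs, lying strictly on opposite
  sides of the chord through the points. The affine function \<open>f\<close> of the proof vanishes exactly on
  that chord, so a connected set meeting both sides would have to contain one of the two points.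
\<close>
lemma no_arc_across_two_gaps:
  assumes conn: "connected A" and sub: "A \<subseteq> circle"
    and st: "- pi < s" "s < t" "t \<le> pi" and gaps: "cis s \<notin> A" "cis t \<notin> A"
    and inside: "s < a" "a < t" "cis a \<in> A"
    and outside: "- pi < b" "b \<le> pi" "b < s \<or> t < b" "cis b \<in> A"
  shows False
proof -
  define f where "f z = Re (z * cnj (cis ((s + t) / 2))) - cos ((t - s) / 2)" for z
  have f: "f (cis u) = 2 * sin ((u - s) / 2) * sin ((t - u) / 2)" for u
  proof -
    have "f (cis u) = cos (u - (s + t) / 2) - cos ((t - s) / 2)"
      unfolding f_def by (simp add: cos_diff)
    also have "\<dots> = 2 * sin (((u - (s + t) / 2) + (t - s) / 2) / 2)
        * sin (((t - s) / 2 - (u - (s + t) / 2)) / 2)"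
      by (rule cos_diff_cos)
    also have "((u - (s + t) / 2) + (t - s) / 2) / 2 = (u - s) / 2"
      by (simp add: field_simps)
    also have "((t - s) / 2 - (u - (s + t) / 2)) / 2 = (t - u) / 2"
      by (simp add: field_simps)
    finally show ?thesis .
  qed
  have pos: "0 < sin ((u - v) / 2)" if "v < u" "- pi < v" "u \<le> pi" for u v :: real
    using that by (intro sin_gt_zero) auto
  have neg: "sin ((u - v) / 2) < 0" if "u < v" "- pi < u" "v \<le> pi" for u v :: real
  proof -
    have "sin ((u - v) / 2) = - sin ((v - u) / 2)"
      by (metis minus_diff_eq minus_divide_left sin_minus)
    then show ?thesis using pos[of u v] that by simp
  qed
  have fa: "f (cis a) > 0"
    unfolding f using inside st pos[of s a] pos[of a t] by auto
  have fb: "f (cis b) < 0"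
  proof (cases "b < s")
    case True
    then show ?thesis unfolding f using outside st neg[of b s] pos[of b t]
      by (auto simp: mult_less_0_iff)
  next
    case False
    then show ?thesis unfolding f using outside st pos[of s b] neg[of t b]
      by (auto simp: mult_less_0_iff)
  qed
  have "continuous_on A f" unfolding f_def by (intro continuous_intros)
  then have "connected (f ` A)" using conn by (rule connected_continuous_image)
  then have "0 \<in> f ` A"
    using connectedD_interval[of "f ` A" "f (cis b)" "f (cis a)" 0] fa fb inside outside by auto
  then obtain z where z: "z \<in> A" "f z = 0" by auto
  define u where "u = Arg z"
  have "norm z = 1" using z sub by (auto simp: circle_def)
  then have zu: "z = cis u" "- pi < u" "u \<le> pi"
    using Arg_bounded[of z] cis_Arg[of z] by (cases "z = 0"; auto simp: u_def sgn_eq)+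
  then have "sin ((u - s) / 2) = 0 \<or> sin ((t - u) / 2) = 0"
    using z f[of u] by auto
  moreover have "u \<noteq> s" "u \<noteq> t" using z zu gaps by auto
  ultimately show False
    using pos[of s u] neg[of u s] pos[of u t] neg[of t u] zu st by fastforce
qed

text \<open>
  Measurability is a real obligation: \<open>arc_length\<close> would be 0 for a non-measurable set of
  angles. Cut open at \<open>\<pi>\<close>, an arc becomes either an interval or the complement of one.
\<close>
lemma arc_angles_measurable:
  assumes "is_arc A"
  shows "{t \<in> {- pi<..pi}. cis t \<in> A} \<in> lmeasurable"
proof -
  define S where "S = {t \<in> {- pi<..pi}. cis t \<in> A}"
  have conn: "connected A" "A \<subseteq> circle" using assms by (auto simp: is_arc_def)
  have "S \<in> sets borel"
  proof (cases "is_interval S")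
    case True
    then show ?thesis by (rule real_interval_borel_measurable)
  next
    case False
    then obtain a b c where abc: "a \<in> S" "b \<in> S" "a \<le> c" "c \<le> b" "c \<notin> S"
      unfolding is_interval_1 by blast
    then have lt: "a < c" "c < b" by (auto simp: less_le)
    \<comment> \<open>If \<open>S\<close> is not an interval, its complement has to be one: otherwise two gaps would
      enclose a point of \<open>S\<close>, hence all of \<open>S\<close>, and the gap \<open>c\<close> inside \<open>S\<close> would be a third one.\<close>
    define T where "T = {- pi<..pi} - S"
    have "is_interval T"
      unfolding is_interval_1
    proof (intro ballI allI impI)
      fix p q e assume pq: "p \<in> T" "q \<in> T" "p \<le> e \<and> e \<le> q"
      show "e \<in> T"
      proof (rule ccontr)
        assume "e \<notin> T"
        then have e: "e \<in> S" "p < e" "e < q" using pq by (auto simp: T_def less_le)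
        have "p < d \<and> d < q" if "d \<in> S" for d
        proof (rule ccontr)
          assume "\<not> (p < d \<and> d < q)"
          then have "d < p \<or> q < d" using that pq by (auto simp: T_def less_le)
          then show False
            using no_arc_across_two_gaps[OF conn, of p q e d] that pq e by (auto simp: T_def S_def)
        qed
        then have "p < a" using abc by auto
        then show False
          using no_arc_across_two_gaps[OF conn, of p c a b] pq abc lt by (auto simp: T_def S_def)
      qed
    qed
    then have "T \<in> sets borel" by (rule real_interval_borel_measurable)
    moreover have "S = {- pi<..pi} - T" by (auto simp: T_def S_def)
    ultimately show ?thesis by auto
  qed
  then have "S \<in> sets lebesgue" using sets_completionI_sets by fastforce
  moreover have "bounded S" 
    by (rule bounded_subset[of "{- pi..pi}"]) (auto simp: S_def)
  ultimately show ?thesis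
    unfolding S_def[symmetric] using bounded_set_imp_lmeasurable by blast
qed

text \<open>
  Of the two circular arcs joining the two points, at least one lies in \<open>A\<close> up to its
  endpoints; its length is \<open>b - a\<close> or \<open>2\<pi> - (b - a)\<close>, and both have the same cosine.
\<close>
lemma arc_chord_bound_ordered:
  assumes arc: "is_arc A" and len: "arc_length A \<le> pi"
    and ab: "- pi < a" "a \<le> b" "b \<le> pi" "cis a \<in> A" "cis b \<in> A"
  shows "cos (arc_length A) \<le> cos (b - a)"
proof -
  define S where "S = {t \<in> {- pi<..pi}. cis t \<in> A}"
  have conn: "connected A" "A \<subseteq> circle" using arc by (auto simp: is_arc_def)
  have S: "S \<in> lmeasurable" unfolding S_def by (rule arc_angles_measurable[OF arc])
  have len_S: "arc_length A = measure lebesgue S" by (simp add: arc_length_def S_def)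
  show ?thesis
  proof (cases "{a<..<b} \<subseteq> S")
    case True
    then have "measure lebesgue {a<..<b} \<le> measure lebesgue S"
      using S by (intro measure_mono_fmeasurable) auto
    then have "b - a \<le> arc_length A" using ab len_S by simp
    then show ?thesis using ab len by (intro cos_monotone_0_pi_le) auto
  next
    case False
    then obtain c where c: "a < c" "c < b" "c \<notin> S" by fastforce
    have out: "e \<in> S" if "- pi < e" "e \<le> pi" "e < a \<or> b < e" for e
      using no_arc_across_two_gaps[OF conn, of c e b a] no_arc_across_two_gaps[OF conn, of e c a b]
        that ab c by (auto simp: S_def)
    have "{- pi<..<a} \<union> {b<..<pi} \<subseteq> S" using out ab by auto
    then have "measure lebesgue ({- pi<..<a} \<union> {b<..<pi}) \<le> measure lebesgue S"
      using S by (intro measure_mono_fmeasurable) auto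
    moreover have "measure lebesgue ({- pi<..<a} \<union> {b<..<pi})
        = measure lebesgue {- pi<..<a} + measure lebesgue {b<..<pi}"
      using ab by (intro measure_Un3[THEN trans]) auto
    ultimately have "2 * pi - (b - a) \<le> arc_length A" using ab len_S by simp
    then have "cos (arc_length A) \<le> cos (2 * pi - (b - a))"
      using ab len by (intro cos_monotone_0_pi_le) auto
    then show ?thesis by (simp add: cos_diff)
  qed
qed

lemma arc_chord_bound:
  assumes "is_arc A" "arc_length A \<le> pi" "z \<in> A" "w \<in> A"
  shows "cos (arc_length A) \<le> Re (z * cnj w)"
proof -
  have unit: "\<exists>t. - pi < t \<and> t \<le> pi \<and> u = cis t" if "u \<in> A" for u
  proof -
    have "norm u = 1" using that assms(1) by (auto simp: is_arc_def circle_def)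
    then have "u = cis (Arg u)" using cis_Arg[of u] by (cases "u = 0") (auto simp: sgn_eq)
    then show ?thesis using Arg_bounded by blast
  qed
  obtain a b where a: "- pi < a" "a \<le> pi" "z = cis a" and b: "- pi < b" "b \<le> pi" "w = cis b"
    using unit assms(3,4) by meson
  have "Re (z * cnj w) = cos (b - a)" using a b by (simp add: cos_diff mult.commute)
  moreover have "cos (arc_length A) \<le> cos (b - a)"
  proof (cases "a \<le> b")
    case True
    then show ?thesis using arc_chord_bound_ordered assms a b by blast
  next
    case False
    then have "cos (arc_length A) \<le> cos (a - b)"
      using arc_chord_bound_ordered[OF assms(1,2), of b a] assms a b by simp
    then show ?thesis by (metis cos_minus minus_diff_eq)
  qed
  ultimately show ?thesis by simp
qed

text \<open>
  Stating closeness through the cosine makes it insensitive to the choice of lift, and turns it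
  into a closed condition on the torus, so that it passes to the closure of \<open>Delta \<gamma>\<close>.
\<close>
lemma Delta_bar_phase_differences:
  assumes "to_torus \<theta> \<in> Delta_bar \<gamma>" "\<gamma> \<le> pi"
  shows "cos \<gamma> \<le> cos (\<theta> $ i - \<theta> $ j)"
proof -
  have Re: "Re (to_torus \<theta> $ i * cnj (to_torus \<theta> $ j)) = cos (\<theta> $ i - \<theta> $ j)"
    by (simp add: to_torus_def cos_diff)
  let ?C = "{z :: complex^'a. cos \<gamma> \<le> Re (z $ i * cnj (z $ j))}"
  have closed: "closed ?C" by (intro closed_Collect_le continuous_intros)
  have "Delta \<gamma> \<subseteq> ?C"
  proof
    fix z :: "complex^'a" assume "z \<in> Delta \<gamma>"
    then obtain A where A: "is_arc A" "arc_length A = \<gamma>"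
        and "\<forall>i. z $ i \<in> top_of_set circle interior_of A"
      by (auto simp: Delta_def)
    then have "z $ i \<in> A" "z $ j \<in> A" using interior_of_subset[of _ A] by blast+
    then show "z \<in> ?C" using arc_chord_bound[OF A(1)] A(2) assms(2) by auto
  qed
  then have cl: "closure (Delta \<gamma>) \<subseteq> ?C" using closed by (rule closure_minimal)
  show ?thesis
  proof (cases "to_torus \<theta> \<in> closure (Delta \<gamma>)")
    case True
    then show ?thesis using cl Re by auto
  next
    case False
    then have "to_torus \<theta> \<in> torus" "to_torus \<theta> $ i = to_torus \<theta> $ j"
      using assms(1) by (auto simp: Delta_bar_def)
    then have "cos (\<theta> $ i - \<theta> $ j) = 1"
      unfolding Re[symmetric] by (simp add: to_torus_def complex_eq_iff cos_squared_eq 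
        power2_eq_square[symmetric])
    then show ?thesis by simp
  qed
qed

text \<open>
  Reducing \<open>d\<close> to its representative in \<open>[-\<pi>, \<pi>]\<close> turns the hypothesis into
  \<open>\<bar>d\<bar> \<le> \<gamma>\<close>.
\<close>
lemma cos_phase_shift_lower_bound:
  assumes "cos \<gamma> \<le> cos d" and "0 \<le> \<gamma>" "0 \<le> \<phi>" "\<phi> \<le> p" "\<gamma> + p \<le> pi"
  shows "cos (\<gamma> + p) \<le> cos (d + \<phi>)"
proof -
  define e where "e = Arg (cis d)"
  have "cis e = cis d" unfolding e_def using cis_Arg[of "cis d"] by (simp add: sgn_eq)
  then have e: "cos e = cos d" "sin e = sin d" by (simp_all add: complex_eq_iff)
  have "\<bar>e\<bar> \<le> pi" using Arg_bounded[of "cis d"] by (auto simp: e_def)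
  moreover have "cos \<gamma> \<le> cos \<bar>e\<bar>" using assms(1) e by simp
  ultimately have "\<bar>e\<bar> \<le> \<gamma>" using assms cos_mono_le_eq[of \<gamma> "\<bar>e\<bar>"] by auto
  then have "cos (\<gamma> + p) \<le> cos \<bar>e + \<phi>\<bar>" using assms by (intro cos_monotone_0_pi_le) auto
  also have "\<dots> = cos (d + \<phi>)" using e by (simp add: cos_add)
  finally show ?thesis .
qed

section \<open>Exponential decay of real functions\<close>

lemma geometric_imp_exponential_decay:
  fixes d :: "real \<Rightarrow> real"
  assumes mono: "\<And>s t. 0 \<le> s \<Longrightarrow> s \<le> t \<Longrightarrow> d t \<le> d s"
    and nonneg: "\<And>t. 0 \<le> t \<Longrightarrow> 0 \<le> d t"
    and contr: "\<And>t. 0 \<le> t \<Longrightarrow> d (t + T) \<le> \<rho> * d t"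
    and T: "0 < T" and \<rho>: "0 < \<rho>" "\<rho> < 1"
  shows "\<exists>C r. r > 0 \<and> (\<forall>t\<ge>0. d t \<le> C * exp (- r * t))"
proof -
  have iter: "d (real n * T) \<le> \<rho> ^ n * d 0" for n
  proof (induction n)
    case (Suc n)
    have "d (real (Suc n) * T) = d (real n * T + T)" by (simp add: algebra_simps)
    also have "\<dots> \<le> \<rho> * d (real n * T)" using T by (intro contr) auto
    also have "\<dots> \<le> \<rho> * (\<rho> ^ n * d 0)" using Suc \<rho> by (intro mult_left_mono) auto
    finally show ?case by (simp add: mult.assoc)
  qed simp
  define r where "r = - ln \<rho> / T"
  have "d t \<le> (d 0 / \<rho>) * exp (- r * t)" if t: "0 \<le> t" for t
  proof -
    define n where "n = nat \<lfloor>t / T\<rfloor>"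
    have "real n = of_int \<lfloor>t / T\<rfloor>" using t T by (simp add: n_def)
    then have n: "real n \<le> t / T" "t / T - 1 \<le> real n" by linarith+
    have "d t \<le> d (real n * T)" using n T by (intro mono) (auto simp: field_simps)
    also have "\<dots> \<le> \<rho> ^ n * d 0" by (rule iter)
    also have "\<rho> ^ n = exp (real n * ln \<rho>)" using \<rho> by (simp add: exp_of_nat_mult)
    also have "exp (real n * ln \<rho>) * d 0 \<le> exp ((t / T - 1) * ln \<rho>) * d 0"
      using n \<rho> nonneg[of 0] by (intro mult_right_mono) (auto intro: mult_right_mono_neg)
    also have "(t / T - 1) * ln \<rho> = - r * t - ln \<rho>"
      by (simp add: r_def algebra_simps)
    also have "exp (- r * t - ln \<rho>) = exp (- r * t) / \<rho>"
      using \<rho> by (simp add: exp_diff)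
    finally show ?thesis by (simp add: field_simps)
  qed
  moreover have "r > 0" using \<rho> T by (simp add: r_def divide_neg_pos)
  ultimately show ?thesis by blast
qed

lemma gronwall_decay:
  fixes W :: "real \<Rightarrow> real"
  assumes d: "\<And>t. 0 \<le> t \<Longrightarrow> (W has_real_derivative W' t) (at t within {0..})"
    and le: "\<And>t. 0 \<le> t \<Longrightarrow> W' t \<le> l * W t" and t: "0 \<le> t"
  shows "W t \<le> W 0 * exp (l * t)"
proof -
  have "((\<lambda>s. W s * exp (- l * s)) has_real_derivative (W' s - l * W s) * exp (- l * s))
      (at s within {0..t})" if "0 \<le> s" for s
    using DERIV_subset[OF d[OF that], of "{0..t}"]
    by (auto intro!: derivative_eq_intros simp: algebra_simps)
  then have "\<exists>\<xi>\<in>{0..t}. W t * exp (- l * t) - W 0 * exp (- l * 0)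
      = (W' \<xi> - l * W \<xi>) * exp (- l * \<xi>) * (t - 0)"
    using t unfolding has_field_derivative_def
    by (intro mvt_very_simple[of 0 t "\<lambda>s. W s * exp (- l * s)"
          "\<lambda>s h. (W' s - l * W s) * exp (- l * s) * h"]) auto
  then obtain \<xi> where \<xi>: "0 \<le> \<xi>" "W t * exp (- l * t) - W 0 = (W' \<xi> - l * W \<xi>) * exp (- l * \<xi>) * t"
    by auto
  have "(W' \<xi> - l * W \<xi>) * exp (- l * \<xi>) * t \<le> 0"
    using le[OF \<xi>(1)] t by (intro mult_nonpos_nonneg) auto
  then have "W t * exp (- l * t) \<le> W 0" using \<xi> by simp
  then have "W t * exp (- l * t) * exp (l * t) \<le> W 0 * exp (l * t)" by (intro mult_right_mono) auto
  then show ?thesis by (simp add: mult.assoc exp_add[symmetric])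
qed

lemma converges_exponentially_imp_tendsto:
  assumes "converges_exponentially f l"
  shows "(f \<longlongrightarrow> l) at_top"
proof -
  obtain C r where C: "r > 0" "\<And>t. 0 \<le> t \<Longrightarrow> \<bar>f t - l\<bar> \<le> C * exp (- r * t)"
    using assms by (auto simp: converges_exponentially_def)
  have "((\<lambda>t. exp (- r * t)) \<longlongrightarrow> 0) at_top"
    using C(1) by (intro exp_at_bot[THEN filterlim_compose]
        filterlim_tendsto_neg_mult_at_bot[OF tendsto_const] filterlim_ident) auto
  then have "((\<lambda>t. C * exp (- r * t)) \<longlongrightarrow> 0) at_top" by (rule tendsto_mult_right_zero)
  moreover have "\<forall>\<^sub>F t in at_top. norm (f t - l) \<le> C * exp (- r * t)"
    using eventually_ge_at_top[of 0] by (rule eventually_mono) (use C(2) in auto)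
  ultimately have "((\<lambda>t. f t - l) \<longlongrightarrow> 0) at_top" by (rule Lim_null_comparison[rotated])
  then show ?thesis by (rule LIM_zero_cancel)
qed

section \<open>Linear consensus dynamics\<close>

text \<open>
  An edge \<open>(i, j)\<close> makes node \<open>i\<close> follow node \<open>j\<close>. The normalization \<open>c \<le> 1\<close> makes the powers of
  \<open>c\<close> decreasing, so that a longer path gives a weaker bound.
\<close>
locale consensus_flow =
  fixes x :: "real \<Rightarrow> 'n::finite \<Rightarrow> real" and a :: "real \<Rightarrow> 'n \<Rightarrow> 'n \<Rightarrow> real"
    and E :: "('n \<times> 'n) set" and c K :: real
  assumes flow: "0 \<le> t \<Longrightarrow>
      ((\<lambda>t. x t i) has_real_derivative (\<Sum>j\<in>UNIV. a t i j * (x t j - x t i))) (at t within {0..})"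
    and weight_nonneg: "0 \<le> t \<Longrightarrow> 0 \<le> a t i j"
    and weight_sum: "0 \<le> t \<Longrightarrow> (\<Sum>j\<in>UNIV. a t i j) \<le> K"
    and weight_edge: "0 \<le> t \<Longrightarrow> (i, j) \<in> E \<Longrightarrow> c \<le> a t i j"
    and c: "0 < c" "c \<le> 1"
begin

lemma reflected: "consensus_flow (\<lambda>t i. - x t i) a E c K"
proof
  fix t :: real and i :: 'n assume t: "0 \<le> t"
  have "(\<Sum>j\<in>UNIV. a t i j * (- x t j - - x t i)) = - (\<Sum>j\<in>UNIV. a t i j * (x t j - x t i))"
    by (simp add: sum_negf[symmetric] algebra_simps)
  then show "((\<lambda>t. - x t i) has_real_derivative
      (\<Sum>j\<in>UNIV. a t i j * (- x t j - - x t i))) (at t within {0..})"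
    using flow[OF t, of i] by (auto intro: derivative_eq_intros)
qed (use weight_nonneg weight_sum weight_edge c in auto)

text \<open>
  A node attaining the minimum is pulled upwards only. To turn this into a strict inequality, the
  slope \<open>\<epsilon>\<close> is added: the minimum of \<open>x\<^sub>i(\<tau>) + \<epsilon> (\<tau> - s)\<close> over \<open>{s..t}\<close> and all nodes cannot occur
  after time \<open>s\<close>, since there the derivative would be positive.
\<close>
lemma lower_bound_persists:
  assumes st: "0 \<le> s" "s \<le> t" and low: "\<And>i. m \<le> x s i"
  shows "m \<le> x t i"
proof -
  have perturbed: "m \<le> x t i + \<epsilon> * (t - s)" if \<epsilon>: "\<epsilon> > 0" for \<epsilon>
  proof -
    define v where "v \<tau> i = x \<tau> i + \<epsilon> * (\<tau> - s)" for \<tau> i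
    have dv: "((\<lambda>\<tau>. v \<tau> i) has_real_derivative
        (\<Sum>j\<in>UNIV. a \<tau> i j * (x \<tau> j - x \<tau> i)) + \<epsilon>) (at \<tau> within {s..t})"
      if "\<tau> \<in> {s..t}" for \<tau> i
    proof -
      have "((\<lambda>\<tau>. v \<tau> i) has_real_derivative
        (\<Sum>j\<in>UNIV. a \<tau> i j * (x \<tau> j - x \<tau> i)) + \<epsilon>) (at \<tau> within {0..})"
        unfolding v_def using that st by (auto intro!: derivative_eq_intros flow)
      then show ?thesis using st by (rule_tac DERIV_subset) auto
    qed
    have "\<exists>\<sigma>. \<sigma> \<in> {s..t} \<and> (\<forall>\<tau>\<in>{s..t}. v \<sigma> i \<le> v \<tau> i)" for i
    proof -
      have "continuous_on {s..t} (\<lambda>\<tau>. v \<tau> i)" using dv by (rule DERIV_continuous_on)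
      then show ?thesis using continuous_attains_inf[of "{s..t}" "\<lambda>\<tau>. v \<tau> i"] st by auto
    qed
    then obtain \<sigma> where \<sigma>: "\<And>i. \<sigma> i \<in> {s..t}" "\<And>i \<tau>. \<tau> \<in> {s..t} \<Longrightarrow> v (\<sigma> i) i \<le> v \<tau> i"
      by metis
    have "\<exists>k. \<forall>i. v (\<sigma> k) k \<le> v (\<sigma> i) i"
    proof -
      have "Min (range (\<lambda>i. v (\<sigma> i) i)) \<in> range (\<lambda>i. v (\<sigma> i) i)" by (intro Min_in) auto
      then obtain k where k: "Min (range (\<lambda>i. v (\<sigma> i) i)) = v (\<sigma> k) k" by (rule imageE)
      have "v (\<sigma> k) k \<le> v (\<sigma> i) i" for i unfolding k[symmetric] by (rule Min_le) auto
      then show ?thesis by blast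
    qed
    then obtain k where k: "\<And>i. v (\<sigma> k) k \<le> v (\<sigma> i) i" by blast
    have min: "v (\<sigma> k) k \<le> v \<tau> i" if "\<tau> \<in> {s..t}" for \<tau> i
      using k \<sigma>(2)[OF that] order_trans by blast
    have "\<sigma> k = s"
    proof (rule ccontr)
      assume "\<sigma> k \<noteq> s"
      then have late: "s < \<sigma> k" "\<sigma> k \<le> t" using \<sigma>(1)[of k] by auto
      have "0 \<le> (\<Sum>j\<in>UNIV. a (\<sigma> k) k j * (x (\<sigma> k) j - x (\<sigma> k) k))"
        using min[OF \<sigma>(1)[of k]] late st weight_nonneg
        by (intro sum_nonneg mult_nonneg_nonneg) (auto simp: v_def)
      then obtain d where d: "d > 0"
        "\<And>h. 0 < h \<Longrightarrow> \<sigma> k - h \<in> {s..t} \<Longrightarrow> h < d \<Longrightarrow> v (\<sigma> k - h) k < v (\<sigma> k) k"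
        using has_real_derivative_pos_inc_left[OF dv[OF \<sigma>(1)]] \<epsilon> by (meson add_nonneg_pos)
      define h where "h = min (d / 2) (\<sigma> k - s)"
      have "0 < h" "h < d" "\<sigma> k - h \<in> {s..t}" using d(1) late by (auto simp: h_def)
      then show False using d(2)[of h] min[of "\<sigma> k - h" k] by force
    qed
    then have "m \<le> v (\<sigma> k) k" using low by (simp add: v_def)
    also have "\<dots> \<le> v t i" using min st by auto
    finally show ?thesis by (simp add: v_def)
  qed
  show ?thesis
  proof (rule field_le_epsilon)
    fix e :: real assume e: "0 < e"
    have "m \<le> x t i + e / (t - s + 1) * (t - s)" using e st by (intro perturbed) auto
    also have "e / (t - s + 1) * (t - s) \<le> e" using e st by (simp add: field_simps)
    finally show "m \<le> x t i + e" by simp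
  qed
qed

text \<open>
  The integrating factor \<open>exp (K t)\<close> outweighs the decay caused by a node's own terms, so that, above
  a lower bound \<open>m\<close>, every scaled value is nondecreasing and grows with its neighbours.
\<close>
definition scaled :: "real \<Rightarrow> real \<Rightarrow> 'n \<Rightarrow> real" where
  "scaled m t i = exp (K * t) * (x t i - m)"

lemma scaled_nonneg:
  assumes "0 \<le> s" "s \<le> t" "\<And>i. m \<le> x s i"
  shows "0 \<le> scaled m t i"
  using lower_bound_persists[OF assms] by (simp add: scaled_def)

text \<open>
  The mean value theorem for \<open>scaled\<close>. In its derivative the self-coupling becomes
  \<open>(K - \<Sum>\<^sub>j a\<^sub>i\<^sub>j) scaled\<^sub>i\<close>, the nonnegative part \<open>b\<close>.
\<close>
lemma scaled_increment:
  assumes st: "0 \<le> s" "s \<le> t" and low: "\<And>i. m \<le> x s i"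
  obtains \<xi> b where "s \<le> \<xi>" "\<xi> \<le> t" "0 \<le> b"
    "scaled m t i - scaled m s i = (b + (\<Sum>j\<in>UNIV. a \<xi> i j * scaled m \<xi> j)) * (t - s)"
proof -
  let ?g = "\<lambda>\<tau>. (K - (\<Sum>j\<in>UNIV. a \<tau> i j)) * scaled m \<tau> i"
  have d: "((\<lambda>\<tau>. scaled m \<tau> i) has_real_derivative
      ?g \<tau> + (\<Sum>j\<in>UNIV. a \<tau> i j * scaled m \<tau> j)) (at \<tau> within {s..t})"
    if "s \<le> \<tau>" "\<tau> \<le> t" for \<tau>
  proof -
    have "?g \<tau> + (\<Sum>j\<in>UNIV. a \<tau> i j * scaled m \<tau> j) =
        exp (K * \<tau>) * (K * (x \<tau> i - m) + (\<Sum>j\<in>UNIV. a \<tau> i j * (x \<tau> j - x \<tau> i)))"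
      by (simp add: scaled_def algebra_simps sum_subtractf sum.distrib sum_distrib_left
          sum_distrib_right)
    then have "((\<lambda>\<tau>. scaled m \<tau> i) has_real_derivative
        ?g \<tau> + (\<Sum>j\<in>UNIV. a \<tau> i j * scaled m \<tau> j)) (at \<tau> within {0..})"
      unfolding scaled_def using that st
      by (auto intro!: derivative_eq_intros flow simp: algebra_simps)
    then show ?thesis using st by (rule_tac DERIV_subset) auto
  qed
  obtain \<xi> where \<xi>: "\<xi> \<in> {s..t}"
    "scaled m t i - scaled m s i = (?g \<xi> + (\<Sum>j\<in>UNIV. a \<xi> i j * scaled m \<xi> j)) * (t - s)"
    using mvt_very_simple[of s t "\<lambda>\<tau>. scaled m \<tau> i"
        "\<lambda>\<tau> h. (?g \<tau> + (\<Sum>j\<in>UNIV. a \<tau> i j * scaled m \<tau> j)) * h"] st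
      d[unfolded has_field_derivative_def] by blast
  moreover have "0 \<le> ?g \<xi>"
    using \<xi>(1) st weight_sum[of \<xi> i] scaled_nonneg[OF st(1) _ low, of \<xi> i] by auto
  ultimately show ?thesis using that[of \<xi> "?g \<xi>"] by auto
qed

lemma scaled_mono:
  assumes st: "0 \<le> s" "s \<le> t" and low: "\<And>i. m \<le> x s i"
  shows "scaled m s i \<le> scaled m t i"
proof -
  obtain \<xi> b where \<xi>: "s \<le> \<xi>" "\<xi> \<le> t" "0 \<le> b"
    "scaled m t i - scaled m s i = (b + (\<Sum>j\<in>UNIV. a \<xi> i j * scaled m \<xi> j)) * (t - s)"
    using scaled_increment[OF assms] by blast
  have "0 \<le> (\<Sum>j\<in>UNIV. a \<xi> i j * scaled m \<xi> j)"
    using \<xi> st weight_nonneg scaled_nonneg[OF st(1) \<xi>(1) low]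
    by (intro sum_nonneg mult_nonneg_nonneg) auto
  then have "0 \<le> scaled m t i - scaled m s i" using \<xi> st by simp
  then show ?thesis by simp
qed

text \<open>
  Since the scaled values never decrease, node \<open>i\<close> collects at rate at least \<open>c\<close> times
  the value of \<open>j\<close> at time \<open>s\<close>, throughout one unit of time.
\<close>
lemma scaled_edge:
  assumes s: "0 \<le> s" and low: "\<And>i. m \<le> x s i" and edge: "(i, j) \<in> E"
  shows "c * scaled m s j \<le> scaled m (s + 1) i"
proof -
  obtain \<xi> b where \<xi>: "s \<le> \<xi>" "\<xi> \<le> s + 1" "0 \<le> b"
    "scaled m (s + 1) i - scaled m s i = (b + (\<Sum>j\<in>UNIV. a \<xi> i j * scaled m \<xi> j)) * (s + 1 - s)"
    using scaled_increment[OF s _ low, of "s + 1" i] by auto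
  have nn: "0 \<le> scaled m \<xi> l" for l using scaled_nonneg[OF s \<xi>(1) low] .
  have "c * scaled m s j \<le> a \<xi> i j * scaled m \<xi> j"
    using \<xi> s edge c nn scaled_mono[OF s \<xi>(1) low] scaled_nonneg[OF s order_refl low]
    by (intro mult_mono weight_edge) (auto intro: weight_nonneg)
  also have "\<dots> \<le> (\<Sum>j\<in>UNIV. a \<xi> i j * scaled m \<xi> j)"
    using \<xi> s nn weight_nonneg by (intro member_le_sum) auto
  also have "\<dots> \<le> scaled m (s + 1) i"
    using \<xi> scaled_nonneg[OF s order_refl low, of i] by simp
  finally show ?thesis .
qed

text \<open>
  One unit of time is spent on each edge of the path.
\<close>
lemma scaled_path:
  assumes s: "0 \<le> s" and low: "\<And>i. m \<le> x s i" and path: "(i, k) \<in> E ^^ l"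
  shows "c ^ l * scaled m s k \<le> scaled m (s + real l) i"
  using path
proof (induction l arbitrary: i)
  case (Suc l)
  then obtain j where j: "(i, j) \<in> E" "(j, k) \<in> E ^^ l" by (meson relpow_Suc_D2)
  have "c ^ Suc l * scaled m s k \<le> c * scaled m (s + real l) j"
    using Suc.IH[OF j(2)] c by (simp add: mult.assoc)
  also have "\<dots> \<le> scaled m (s + real l + 1) i"
    using s j(1) lower_bound_persists[OF s _ low] by (intro scaled_edge) auto
  finally show ?case by (simp add: algebra_simps)
qed simp

text \<open>
  Nodes whose path to \<open>k\<close> is shorter than \<open>N\<close> keep their gain by monotonicity, so that a single
  time span serves all nodes.
\<close>
lemma root_lifts_all:
  assumes s: "0 \<le> s" and low: "\<And>i. m \<le> x s i"
    and path: "(i, k) \<in> E ^^ l" "l \<le> N"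
  shows "exp (- K * real N) * c ^ N * (x s k - m) \<le> x (s + real N) i - m"
proof -
  have "c ^ N * scaled m s k \<le> c ^ l * scaled m s k"
    using c path scaled_nonneg[OF s order_refl low, of k]
    by (intro mult_right_mono power_decreasing) auto
  also have "\<dots> \<le> scaled m (s + real l) i" by (rule scaled_path[OF s low path(1)])
  also have "\<dots> \<le> scaled m (s + real N) i"
    using s path lower_bound_persists[OF s _ low] by (intro scaled_mono) auto
  finally have "exp (- K * (s + real N)) * (c ^ N * scaled m s k)
      \<le> exp (- K * (s + real N)) * scaled m (s + real N) i" by simp
  also have "\<dots> = x (s + real N) i - m" by (simp add: scaled_def exp_minus)
  also have "exp (- K * (s + real N)) * (c ^ N * scaled m s k)
      = exp (- K * (s + real N) + K * s) * c ^ N * (x s k - m)"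
    unfolding exp_add by (simp add: scaled_def)
  finally show ?thesis by (simp add: algebra_simps)
qed

definition lo :: "real \<Rightarrow> real" where "lo t = Min (range (x t))"
definition hi :: "real \<Rightarrow> real" where "hi t = Max (range (x t))"

lemma lo_le: "lo t \<le> x t i" by (simp add: lo_def)
lemma le_hi: "x t i \<le> hi t" by (simp add: hi_def)
lemma lo_ge: "(\<And>i. m \<le> x t i) \<Longrightarrow> m \<le> lo t" by (simp add: lo_def)
lemma hi_le: "(\<And>i. x t i \<le> m) \<Longrightarrow> hi t \<le> m" by (simp add: hi_def)

lemma lo_mono: "0 \<le> s \<Longrightarrow> s \<le> t \<Longrightarrow> lo s \<le> lo t"
  by (intro lo_ge lower_bound_persists[of s t] lo_le)

lemma hi_antimono: "0 \<le> s \<Longrightarrow> s \<le> t \<Longrightarrow> hi t \<le> hi s"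
  using consensus_flow.lower_bound_persists[OF reflected, of s t "- hi s"] le_hi
  by (intro hi_le) auto

text \<open>
  The root \<open>k\<close> is at distance at least half the spread from one of the two extremes. It lifts all
  nodes off the minimum in the one case; in the other the same argument applies to the reflected flow.
\<close>
lemma spread_contracts:
  assumes s: "0 \<le> s" and path: "\<And>i. \<exists>l\<le>N. (i, k) \<in> E ^^ l"
  shows "hi (s + real N) - lo (s + real N)
    \<le> (1 - exp (- K * real N) * c ^ N / 2) * (hi s - lo s)"
proof -
  define \<eta> where "\<eta> = exp (- K * real N) * c ^ N"
  have \<eta>: "\<eta> > 0" using c by (simp add: \<eta>_def)
  have mono: "lo s \<le> lo (s + real N)" "hi (s + real N) \<le> hi s"
    using s by (auto intro: lo_mono hi_antimono)
  show ?thesis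
  proof (cases "(hi s - lo s) / 2 \<le> x s k - lo s")
    case True
    have "lo s + \<eta> * ((hi s - lo s) / 2) \<le> x (s + real N) i" for i
    proof -
      obtain l where "l \<le> N" "(i, k) \<in> E ^^ l" using path by blast
      then have "\<eta> * (x s k - lo s) \<le> x (s + real N) i - lo s"
        unfolding \<eta>_def by (intro root_lifts_all s lo_le)
      moreover have "\<eta> * ((hi s - lo s) / 2) \<le> \<eta> * (x s k - lo s)" using True \<eta> by simp
      ultimately show ?thesis by linarith
    qed
    then have "lo s + \<eta> * ((hi s - lo s) / 2) \<le> lo (s + real N)" by (rule lo_ge)
    with mono show ?thesis unfolding \<eta>_def[symmetric] by (simp add: field_simps)
  next
    case False
    have "x (s + real N) i \<le> hi s - \<eta> * ((hi s - lo s) / 2)" for i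
    proof -
      obtain l where "l \<le> N" "(i, k) \<in> E ^^ l" using path by blast
      then have "\<eta> * (- x s k - - hi s) \<le> - x (s + real N) i - - hi s"
        unfolding \<eta>_def
        by (intro consensus_flow.root_lifts_all[OF reflected] s) (auto simp: le_hi)
      moreover have "\<eta> * ((hi s - lo s) / 2) \<le> \<eta> * (- x s k - - hi s)"
        using False \<eta> by (intro mult_left_mono) auto
      ultimately show ?thesis by linarith
    qed
    then have "hi (s + real N) \<le> hi s - \<eta> * ((hi s - lo s) / 2)" by (rule hi_le)
    with mono show ?thesis unfolding \<eta>_def[symmetric] by (simp add: field_simps)
  qed
qed

theorem exponential_consensus:
  assumes root: "\<And>i. (i, k) \<in> E\<^sup>*"
  shows "\<exists>\<nu>. lo 0 \<le> \<nu> \<and> \<nu> \<le> hi 0 \<and> (\<forall>i. converges_exponentially (\<lambda>t. x t i) \<nu>)"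
proof -
  have "\<exists>l. (i, k) \<in> E ^^ l" for i using root rtrancl_imp_relpow by blast
  then obtain l where l: "\<And>i. (i, k) \<in> E ^^ l i" by metis
  \<comment> \<open>The successor keeps the period positive for a graph with a single node.\<close>
  define N where "N = Suc (Max (range l))"
  have path: "\<exists>l\<le>N. (i, k) \<in> E ^^ l" for i
    using l by (intro exI[of _ "l i"]) (auto simp: N_def le_Suc_eq)
  have K: "0 \<le> K"
  proof -
    have "0 \<le> (\<Sum>j\<in>UNIV. a 0 undefined j)" by (intro sum_nonneg weight_nonneg) simp
    also have "\<dots> \<le> K" by (rule weight_sum) simp
    finally show ?thesis .
  qed
  define \<eta> where "\<eta> = exp (- K * real N) * c ^ N"
  have "\<eta> \<le> 1 * 1" unfolding \<eta>_def using K c by (intro mult_mono power_le_one) auto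
  then have \<eta>: "0 < \<eta>" "\<eta> \<le> 1" using c by (auto simp: \<eta>_def)
  have lo_hi: "lo t \<le> hi t" for t using lo_le le_hi order_trans by blast
  have "\<exists>C r. r > 0 \<and> (\<forall>t\<ge>0. hi t - lo t \<le> C * exp (- r * t))"
  proof (rule geometric_imp_exponential_decay)
    show "hi t - lo t \<le> hi s - lo s" if "0 \<le> s" "s \<le> t" for s t
      using lo_mono[OF that] hi_antimono[OF that] by simp
    show "hi (t + real N) - lo (t + real N) \<le> (1 - \<eta> / 2) * (hi t - lo t)" if "0 \<le> t" for t
      unfolding \<eta>_def by (rule spread_contracts[OF that path])
    show "0 < real N" by (simp add: N_def)
  qed (use \<eta> lo_hi in auto)
  then obtain C r where Cr: "r > 0" "\<And>t. 0 \<le> t \<Longrightarrow> hi t - lo t \<le> C * exp (- r * t)" by blast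
  \<comment> \<open>Every value of \<open>lo\<close> lies below every value of \<open>hi\<close>, so this supremum separates them at all times.\<close>
  define \<nu> where "\<nu> = Sup (lo ` {0..})"
  have cross: "lo s \<le> hi t" if "0 \<le> s" "0 \<le> t" for s t
    using lo_mono[of s "max s t"] hi_antimono[of t "max s t"] lo_hi[of "max s t"] that by simp
  have lo\<nu>: "lo t \<le> \<nu>" if "0 \<le> t" for t
    unfolding \<nu>_def using that cross[of _ 0] by (intro cSup_upper) (auto intro!: bdd_aboveI)
  have \<nu>hi: "\<nu> \<le> hi t" if "0 \<le> t" for t
    unfolding \<nu>_def using that cross by (intro cSup_least) auto
  have "\<bar>x t i - \<nu>\<bar> \<le> C * exp (- r * t)" if "0 \<le> t" for t i
    using lo\<nu>[OF that] \<nu>hi[OF that] lo_le[of t i] le_hi[of t i] Cr(2)[OF that] by linarith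
  then show ?thesis
    using lo\<nu>[of 0] \<nu>hi[of 0] Cr(1) unfolding converges_exponentially_def by fastforce
qed

end

section \<open>Second eigenvalue of the Laplacian\<close>

lemma symmetric_matrix_inner:
  fixes A :: "real^'n^'n"
  assumes "A = transpose A"
  shows "(A *v u) \<bullet> v = u \<bullet> (A *v v)"
proof -
  have "A *v u = u v* A" by (subst assms) (rule transpose_matrix_vector)
  then show ?thesis by (simp add: dot_lmul_matrix)
qed

text \<open>
  Without finiteness \<open>eigenvalue_list\<close> would be empty. Eigenvectors to distinct eigenvalues
  are orthogonal, hence independent.
\<close>
lemma finite_eigenvalues_symmetric:
  fixes A :: "real^'n^'n"
  assumes sym: "A = transpose A"
  shows "finite (eigenvalues A)"
proof -
  have "\<forall>x\<in>eigenvalues A. \<exists>v. v \<noteq> 0 \<and> A *v v = x *\<^sub>R v" by (simp add: eigenvalues_def)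
  then obtain f where "\<forall>x\<in>eigenvalues A. f x \<noteq> 0 \<and> A *v f x = x *\<^sub>R f x"
    by (rule bchoice[THEN exE])
  then have f: "\<And>x. x \<in> eigenvalues A \<Longrightarrow> f x \<noteq> 0 \<and> A *v f x = x *\<^sub>R f x" by blast
  have orth: "f x \<bullet> f y = 0" if "x \<in> eigenvalues A" "y \<in> eigenvalues A" "x \<noteq> y" for x y
  proof -
    have "x * (f x \<bullet> f y) = y * (f x \<bullet> f y)"
      using symmetric_matrix_inner[OF sym, of "f x" "f y"] f that by simp
    then show ?thesis using that by simp
  qed
  have "pairwise orthogonal (f ` eigenvalues A)"
    unfolding pairwise_def orthogonal_def using orth by blast
  moreover have "0 \<notin> f ` eigenvalues A" using f by auto
  ultimately have "finite (f ` eigenvalues A)"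
    by (intro independent_imp_finite pairwise_orthogonal_independent)
  moreover have "inj_on f (eigenvalues A)"
    using orth f by (intro inj_onI) (metis inner_eq_zero_iff)
  ultimately show ?thesis by (rule finite_imageD)
qed

lemma dim_eigenspace_pos:
  assumes "x \<in> eigenvalues A"
  shows "0 < dim (eigenspace A x)"
proof -
  have "\<not> eigenspace A x \<subseteq> {0}" using assms by (auto simp: eigenvalues_def eigenspace_def)
  then show ?thesis using dim_eq_0[of "eigenspace A x"] by blast
qed

text \<open>
  The orthogonal eigenvectors \<open>u\<close> and \<open>v\<close> occupy two places in the list of eigenvalues with
  multiplicity: either \<open>\<mu> = l\<close> and the first block has length at least 2, or \<open>\<mu>\<close> comes in a
  later block. In both cases the entry with index 1 exists and is at most \<open>\<mu>\<close>.
\<close>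
lemma lambda2_le_orthogonal_eigenvalue:
  fixes A :: "real^'n^'n"
  assumes fin: "finite (eigenvalues A)"
    and least: "\<And>x. x \<in> eigenvalues A \<Longrightarrow> l \<le> x"
    and u: "u \<noteq> 0" "A *v u = l *\<^sub>R u" and v: "v \<noteq> 0" "A *v v = \<mu> *\<^sub>R v" and uv: "u \<bullet> v = 0"
  shows "lambda2 A \<in> eigenvalues A" "lambda2 A \<le> \<mu>"
proof -
  let ?E = "eigenvalues A"
  let ?block = "\<lambda>x. replicate (dim (eigenspace A x)) x"
  have l: "l \<in> ?E" and \<mu>: "\<mu> \<in> ?E" using u v by (auto simp: eigenvalues_def)
  have "Min ?E = l" using fin l least by (intro Min_eqI) auto
  then have list: "eigenvalue_list A = ?block l @ concat (map ?block (sorted_list_of_set (?E - {l})))"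
    using sorted_list_of_set_nonempty[OF fin] l by (force simp: eigenvalue_list_def)
  have "lambda2 A \<in> ?E \<and> lambda2 A \<le> \<mu>"
  proof (cases "2 \<le> dim (eigenspace A l)")
    case True
    then have "lambda2 A = l" by (simp add: lambda2_def list nth_append)
    then show ?thesis using l least \<mu> by simp
  next
    case False
    then have one: "dim (eigenspace A l) = 1" using dim_eigenspace_pos[OF l] by simp
    have "\<mu> \<noteq> l"
    proof
      assume "\<mu> = l"
      then have "{u, v} \<subseteq> eigenspace A l" using u v by (auto simp: eigenspace_def)
      moreover have "independent {u, v}"
        using u v uv by (intro pairwise_orthogonal_independent)
          (auto simp: pairwise_def orthogonal_def inner_commute)
      ultimately have "card {u, v} \<le> dim (eigenspace A l)" by (intro independent_card_le_dim)
      moreover have "u \<noteq> v" using u uv by auto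
      ultimately show False using False by simp
    qed
    then have \<mu>': "\<mu> \<in> ?E - {l}" using \<mu> by simp
    define m where "m = Min (?E - {l})"
    have m: "m \<in> ?E - {l}" "m \<le> \<mu>"
      unfolding m_def using fin \<mu>' by (auto intro!: Min_in Min_le simp del: Diff_iff)
    have "sorted_list_of_set (?E - {l}) = m # sorted_list_of_set (?E - {l} - {m})"
      unfolding m_def using fin \<mu>' by (intro sorted_list_of_set_nonempty) auto
    then have "lambda2 A = m"
      using dim_eigenspace_pos[of m A] m by (simp add: lambda2_def list nth_append one)
    then show ?thesis using m by simp
  qed
  then show "lambda2 A \<in> ?E" "lambda2 A \<le> \<mu>" by auto
qed

lemma laplacian_mult: "(laplacian P *v u) $ i = (\<Sum>j\<in>UNIV. P $ i $ j * (u $ i - u $ j))"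
proof -
  have "(laplacian P *v u) $ i =
      (\<Sum>j\<in>UNIV. (if i = j then (\<Sum>j\<in>UNIV. P $ i $ j) else 0) * u $ j) - (\<Sum>j\<in>UNIV. P $ i $ j * u $ j)"
    by (simp add: laplacian_def diag_matrix_def matrix_vector_mult_def left_diff_distrib
        sum_subtractf if_distrib[of "\<lambda>x. x * _"] cong: if_cong)
  also have "(\<Sum>j\<in>UNIV. (if i = j then (\<Sum>j\<in>UNIV. P $ i $ j) else 0) * u $ j)
      = (\<Sum>j\<in>UNIV. P $ i $ j) * u $ i"
    by (simp add: if_distrib[of "\<lambda>x. x * _"] cong: if_cong)
  finally show ?thesis
    by (simp add: right_diff_distrib sum_subtractf sum_distrib_right)
qed

text \<open>
  Summation by parts on a graph: average the sum with its copy in which \<open>i\<close> and \<open>j\<close> are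
  exchanged.
\<close>
lemma dirichlet_form:
  fixes w :: "'n::finite \<Rightarrow> 'n \<Rightarrow> real"
  assumes "\<And>i j. w i j = w j i"
  shows "(\<Sum>i\<in>UNIV. u i * (\<Sum>j\<in>UNIV. w i j * (u i - u j)))
    = (\<Sum>i\<in>UNIV. \<Sum>j\<in>UNIV. w i j * (u i - u j)\<^sup>2) / 2"
proof -
  have "(\<Sum>i\<in>UNIV. \<Sum>j\<in>UNIV. w i j * (u i - u j)\<^sup>2)
      = (\<Sum>i\<in>UNIV. \<Sum>j\<in>UNIV. u i * (w i j * (u i - u j)))
        + (\<Sum>i\<in>UNIV. \<Sum>j\<in>UNIV. u j * (w i j * (u j - u i)))"
    by (simp add: sum.distrib[symmetric] power2_eq_square algebra_simps)
  also have "(\<Sum>i\<in>UNIV. \<Sum>j\<in>UNIV. u j * (w i j * (u j - u i)))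
      = (\<Sum>i\<in>UNIV. \<Sum>j\<in>UNIV. u i * (w i j * (u i - u j)))"
    by (subst sum.swap) (simp add: assms)
  also have "(\<Sum>i\<in>UNIV. \<Sum>j\<in>UNIV. u i * (w i j * (u i - u j)))
      = (\<Sum>i\<in>UNIV. u i * (\<Sum>j\<in>UNIV. w i j * (u i - u j)))"
    by (simp only: sum_distrib_left)
  finally show ?thesis by simp
qed

lemma laplacian_form:
  assumes "P = transpose P"
  shows "u \<bullet> (laplacian P *v u) = (\<Sum>i\<in>UNIV. \<Sum>j\<in>UNIV. P $ i $ j * (u $ i - u $ j)\<^sup>2) / 2"
proof -
  have "P $ i $ j = P $ j $ i" for i j using assms by (metis transpose_def vec_lambda_beta)
  then show ?thesis
    using dirichlet_form[of "\<lambda>i j. P $ i $ j" "\<lambda>i. u $ i"] by (simp add: inner_vec_def laplacian_mult)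
qed

lemma laplacian_symmetric:
  assumes "P = transpose P"
  shows "laplacian P = transpose (laplacian P)"
proof -
  have "P $ i $ j = P $ j $ i" for i j using assms by (metis transpose_def vec_lambda_beta)
  then show ?thesis by (simp add: vec_eq_iff laplacian_def diag_matrix_def transpose_def)
qed

text \<open>
  The Rayleigh quotient attains its minimum on the unit sphere of the orthogonal complement
  of \<open>u\<close>. The complement is invariant under \<open>A\<close>, so the residual \<open>r = A v - \<mu> v\<close> of a
  minimizer \<open>v\<close> is an admissible direction of variation, and stationarity forces it to vanish.
\<close>
lemma rayleigh_minimum_eigenvector:
  fixes A :: "real^'n^'n"
  assumes sym: "A = transpose A" and Au: "A *v u = 0"
    and card: "CARD('n) \<ge> 2"
  obtains v \<mu> where "v \<noteq> 0" "u \<bullet> v = 0" "A *v v = \<mu> *\<^sub>R v"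
    "\<And>w. u \<bullet> w = 0 \<Longrightarrow> \<mu> * (w \<bullet> w) \<le> w \<bullet> (A *v w)"
proof -
  let ?S = "sphere 0 1 \<inter> {w. u \<bullet> w = 0}"
  have "compact ?S" by (intro compact_Int_closed compact_sphere closed_hyperplane)
  moreover have "?S \<noteq> {}"
  proof -
    obtain y where y: "y \<noteq> 0" "orthogonal u y"
      using orthogonal_to_vector_exists[of u] card by auto
    then have "sgn y \<in> ?S" by (simp add: norm_sgn orthogonal_def sgn_div_norm)
    then show ?thesis by blast
  qed
  moreover have "continuous_on ?S (\<lambda>w. w \<bullet> (A *v w))"
    by (intro continuous_intros linear_continuous_on matrix_vector_mul_bounded_linear)
  ultimately obtain v where v: "v \<in> ?S" "\<And>w. w \<in> ?S \<Longrightarrow> v \<bullet> (A *v v) \<le> w \<bullet> (A *v w)"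
    using continuous_attains_inf[of ?S "\<lambda>w. w \<bullet> (A *v w)"] by blast
  define \<mu> where "\<mu> = v \<bullet> (A *v v)"
  have vv: "v \<bullet> v = 1" "u \<bullet> v = 0" using v(1) by (auto simp: norm_eq_1)
  have ray: "\<mu> * (w \<bullet> w) \<le> w \<bullet> (A *v w)" if "u \<bullet> w = 0" for w
  proof (cases "w = 0")
    case False
    have "(1 / norm w) *\<^sub>R w \<in> ?S" using that False by simp
    from v(2)[OF this] have "\<mu> \<le> (w \<bullet> (A *v w)) / (norm w)\<^sup>2"
      by (simp add: \<mu>_def matrix_vector_mult_scaleR power2_eq_square)
    then show ?thesis using False by (simp add: pos_le_divide_eq power2_norm_eq_inner)
  qed simp
  define r where "r = A *v v - \<mu> *\<^sub>R v"
  have ur: "u \<bullet> r = 0"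
    using symmetric_matrix_inner[OF sym, of u v] Au vv by (simp add: r_def inner_diff_right)
  define q where "q = r \<bullet> (A *v r) - \<mu> * (r \<bullet> r)"
  have quad: "0 \<le> 2 * t * (r \<bullet> r) + t\<^sup>2 * q" for t
  proof -
    let ?w = "v + t *\<^sub>R r"
    have ww: "?w \<bullet> ?w = 1 + 2 * t * (v \<bullet> r) + t\<^sup>2 * (r \<bullet> r)"
      using vv by (simp add: inner_add inner_commute power2_eq_square algebra_simps)
    have wAw: "?w \<bullet> (A *v ?w) = \<mu> + 2 * t * (r \<bullet> (A *v v)) + t\<^sup>2 * (r \<bullet> (A *v r))"
      using symmetric_matrix_inner[OF sym, of v r]
      by (simp add: matrix_vector_right_distrib matrix_vector_mult_scaleR inner_add \<mu>_def
          inner_commute power2_eq_square algebra_simps)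
    have rr: "r \<bullet> (A *v v) = r \<bullet> r + \<mu> * (v \<bullet> r)"
      by (subst (2) r_def) (simp add: inner_diff_right inner_commute)
    have "\<mu> * (?w \<bullet> ?w) \<le> ?w \<bullet> (A *v ?w)" using vv ur by (intro ray) (simp add: inner_add_right)
    then show ?thesis unfolding ww wAw rr q_def by (simp add: algebra_simps)
  qed
  have "r = 0"
  proof (rule ccontr)
    assume "r \<noteq> 0"
    then have rr: "r \<bullet> r > 0" by simp
    \<comment> \<open>A negative \<open>t\<close> so small that the linear term of \<open>quad\<close> dominates the quadratic one.\<close>
    define t where "t = - (r \<bullet> r) / (\<bar>q\<bar> + 1)"
    have "t < 0" using rr by (simp add: t_def divide_neg_pos)
    have "- t * \<bar>q\<bar> \<le> r \<bullet> r"
      using rr by (simp add: t_def field_simps)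
    then have "- t * q \<le> r \<bullet> r" using \<open>t < 0\<close> 
      by (smt (verit) mult_left_mono)
    then have "t\<^sup>2 * q \<le> (- t) * (r \<bullet> r)"
      using \<open>t < 0\<close> mult_left_mono[of "- t * q" "r \<bullet> r" "- t"] by (simp add: power2_eq_square algebra_simps)
    moreover have "t * (r \<bullet> r) < 0" using \<open>t < 0\<close> rr by (simp add: mult_neg_pos)
    ultimately show False using quad[of t] by simp
  qed
  then have "A *v v = \<mu> *\<^sub>R v" by (simp add: r_def)
  moreover have "v \<noteq> 0" using vv by auto
  ultimately show ?thesis using that[of v \<mu>] vv ray by blast
qed

text \<open>
  The constant vector spans the bottom of the spectrum, and any eigenvalue with an eigenvector
  orthogonal to it is at least \<open>\<lambda>\<^sub>2\<close>; this applies to the Rayleigh minimum.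
\<close>
lemma laplacian_lambda2:
  fixes P :: "real^'n^'n"
  assumes sym: "P = transpose P" and nonneg: "\<And>i j. 0 \<le> P $ i $ j" and card: "CARD('n) \<ge> 2"
  shows "0 \<le> lambda2 (laplacian P)"
    and "1 \<bullet> w = 0 \<Longrightarrow> lambda2 (laplacian P) * (w \<bullet> w) \<le> w \<bullet> (laplacian P *v w)"
proof -
  let ?L = "laplacian P"
  note symL = laplacian_symmetric[OF sym]
  have one: "?L *v 1 = 0" by (simp add: vec_eq_iff laplacian_mult)
  have psd: "0 \<le> w \<bullet> (?L *v w)" for w
    unfolding laplacian_form[OF sym] using nonneg by (auto intro!: sum_nonneg)
  have least: "0 \<le> x" if x: "x \<in> eigenvalues ?L" for x
  proof -
    obtain v where v: "v \<noteq> 0" "?L *v v = x *\<^sub>R v" using x by (auto simp: eigenvalues_def)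
    then have "0 \<le> x * (v \<bullet> v)" using psd[of v] by simp
    moreover have "0 < v \<bullet> v" using v by simp
    ultimately show ?thesis by (simp add: zero_le_mult_iff)
  qed
  obtain v \<mu> where v: "v \<noteq> 0" "1 \<bullet> v = 0" "?L *v v = \<mu> *\<^sub>R v"
    and ray: "\<And>w. 1 \<bullet> w = 0 \<Longrightarrow> \<mu> * (w \<bullet> w) \<le> w \<bullet> (?L *v w)"
    using rayleigh_minimum_eigenvector[OF symL one card] by metis
  have "lambda2 ?L \<in> eigenvalues ?L" "lambda2 ?L \<le> \<mu>"
    using lambda2_le_orthogonal_eigenvalue[OF finite_eigenvalues_symmetric[OF symL] least, of 1 v \<mu>]
      v one by auto
  then show "0 \<le> lambda2 ?L"
    and "1 \<bullet> w = 0 \<Longrightarrow> lambda2 ?L * (w \<bullet> w) \<le> w \<bullet> (?L *v w)"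
    using least ray[of w] mult_right_mono[of "lambda2 ?L" \<mu> "w \<bullet> w"] by auto
qed

lemma cos_vec_angle: "cos (vec_angle x y) = x \<bullet> y / (norm x * norm y)"
proof -
  have "\<bar>x \<bullet> y / (norm x * norm y)\<bar> \<le> 1"
    using Cauchy_Schwarz_ineq2[of x y] by (auto simp: abs_mult divide_le_eq_1 less_le)
  then show ?thesis by (simp add: vec_angle_def cos_arccos_abs)
qed

text \<open>
  Removing from \<open>v\<close> its component along \<open>u\<close> costs little when \<open>v\<close> is orthogonal to
  a vector \<open>e\<close> close to \<open>u\<close> in direction: in \<open>u \<bullet> v\<close> only the part \<open>p\<close> of \<open>u\<close> orthogonal to \<open>e\<close>
  contributes, whose squared norm is the fraction \<open>1 - cos\<^sup>2\<close> of that of \<open>u\<close>.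
\<close>
lemma projection_norm_lower_bound:
  fixes e u v :: "real^'n"
  assumes ev: "e \<bullet> v = 0" and e: "e \<noteq> 0" and u: "u \<noteq> 0"
  defines "w \<equiv> v - ((u \<bullet> v) / (u \<bullet> u)) *\<^sub>R u"
  shows "u \<bullet> w = 0" "(cos (vec_angle e u))\<^sup>2 * (v \<bullet> v) \<le> w \<bullet> w"
proof -
  have uu: "u \<bullet> u > 0" and ee: "e \<bullet> e > 0" using u e by auto
  show "u \<bullet> w = 0" using uu by (simp add: w_def inner_diff_right)
  have ww: "w \<bullet> w = v \<bullet> v - (u \<bullet> v)\<^sup>2 / (u \<bullet> u)"
    using uu by (simp add: w_def inner_diff inner_commute power2_eq_square field_simps)
  define p where "p = u - ((e \<bullet> u) / (e \<bullet> e)) *\<^sub>R e"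
  have "p \<bullet> p = u \<bullet> u - (e \<bullet> u)\<^sup>2 / (e \<bullet> e)"
    using ee by (simp add: p_def inner_diff inner_commute power2_eq_square field_simps)
  moreover have "u \<bullet> v = p \<bullet> v" using ev by (simp add: p_def inner_diff_left)
  ultimately have "(u \<bullet> v)\<^sup>2 \<le> (u \<bullet> u - (e \<bullet> u)\<^sup>2 / (e \<bullet> e)) * (v \<bullet> v)"
    using Cauchy_Schwarz_ineq[of p v] by simp
  then have "(u \<bullet> v)\<^sup>2 / (u \<bullet> u) \<le> (u \<bullet> u - (e \<bullet> u)\<^sup>2 / (e \<bullet> e)) * (v \<bullet> v) / (u \<bullet> u)"
    using uu by (intro divide_right_mono) auto
  also have "\<dots> = v \<bullet> v - (e \<bullet> u)\<^sup>2 / ((e \<bullet> e) * (u \<bullet> u)) * (v \<bullet> v)"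
    using uu ee by (simp add: field_simps)
  also have "(e \<bullet> u)\<^sup>2 / ((e \<bullet> e) * (u \<bullet> u)) = (cos (vec_angle e u))\<^sup>2"
    by (simp add: cos_vec_angle power_divide power_mult_distrib power2_norm_eq_inner)
  finally show "(cos (vec_angle e u))\<^sup>2 * (v \<bullet> v) \<le> w \<bullet> w" by (simp add: ww)
qed

lemma vec_max_ge: "x $ i \<le> vec_max x"
  by (simp add: vec_max_def)

text \<open>
  The Laplacian form does not see constant shifts, so \<open>v\<close> may be replaced by its part orthogonal
  to \<open>1\<close>, where the variational bound for \<open>\<lambda>\<^sub>2\<close> applies; the factor \<open>cos\<^sup>2\<close> is the price of
  returning to \<open>v\<close>.
\<close>
lemma laplacian_gap_weighted_mean_zero:
  fixes D :: "real^'n" and P :: "real^'n^'n"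
  assumes D: "\<And>i. D $ i > 0" and P: "\<And>i j. P $ i $ j \<ge> 0" and sym: "P = transpose P"
    and card: "CARD('n) \<ge> 2" and mean: "D \<bullet> v = 0"
  shows "lambda2 (laplacian P) * (cos (vec_angle D 1))\<^sup>2 / vec_max D * (\<Sum>i\<in>UNIV. D $ i * (v $ i)\<^sup>2)
    \<le> v \<bullet> (laplacian P *v v)"
proof -
  let ?l = "lambda2 (laplacian P)" and ?c = "(cos (vec_angle D 1))\<^sup>2"
  note gap = laplacian_lambda2[OF sym P card]
  define k where "k = (1 \<bullet> v) / (1 \<bullet> (1 :: real^'n))"
  define w where "w = v - k *\<^sub>R 1"
  have ne: "D \<noteq> 0" "(1 :: real^'n) \<noteq> 0" using D by (auto simp: vec_eq_iff less_le)
  have w: "1 \<bullet> w = 0" "?c * (v \<bullet> v) \<le> w \<bullet> w"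
    using projection_norm_lower_bound[OF mean ne] by (simp_all add: w_def k_def)
  have Dm: "0 < vec_max D" using D vec_max_ge less_le_trans by blast
  have "(\<Sum>i\<in>UNIV. D $ i * (v $ i)\<^sup>2) \<le> (\<Sum>i\<in>UNIV. vec_max D * (v $ i)\<^sup>2)"
    by (intro sum_mono mult_right_mono vec_max_ge) auto
  also have "\<dots> = vec_max D * (v \<bullet> v)"
    by (simp add: inner_vec_def power2_eq_square sum_distrib_left)
  finally have "(\<Sum>i\<in>UNIV. D $ i * (v $ i)\<^sup>2) / vec_max D \<le> v \<bullet> v"
    using Dm by (simp add: field_simps)
  then have "?l * ?c * ((\<Sum>i\<in>UNIV. D $ i * (v $ i)\<^sup>2) / vec_max D) \<le> ?l * ?c * (v \<bullet> v)"
    using gap(1) by (intro mult_left_mono) auto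
  also have "\<dots> \<le> ?l * (w \<bullet> w)" using mult_left_mono[OF w(2) gap(1)] by (simp add: mult.assoc)
  also have "\<dots> \<le> w \<bullet> (laplacian P *v w)" by (rule gap(2)[OF w(1)])
  also have "\<dots> = v \<bullet> (laplacian P *v v)" unfolding laplacian_form[OF sym] by (simp add: w_def)
  finally show ?thesis by simp
qed

section \<open>The Kuramoto model\<close>

lemma mat_max_ge: "A $ i $ j \<le> mat_max A"
proof -
  have "A $ i $ j \<in> range (\<lambda>(i, j). A $ i $ j)" by (rule range_eqI[of _ _ "(i, j)"]) simp
  then show ?thesis unfolding mat_max_def by (intro Max_ge) auto
qed

lemma kuramoto_frequency_derivative:
  assumes sol: "kuramoto_solution D \<omega> P \<phi> \<theta> \<theta>'" and D: "D $ i > 0" and t: "0 \<le> t"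
  shows "((\<lambda>t. \<theta>' t $ i) has_real_derivative
    (\<Sum>j\<in>UNIV. P $ i $ j * cos (\<theta> t $ i - \<theta> t $ j + \<phi> $ i $ j) / D $ i * (\<theta>' t $ j - \<theta>' t $ i)))
    (at t within {0..})"
proof -
  have d: "((\<lambda>t. \<theta> t $ j) has_real_derivative \<theta>' t $ j) (at t within {0..})" for j
  proof -
    have "(\<theta> has_vector_derivative \<theta>' t) (at t within {0..})"
      using sol t by (simp add: kuramoto_solution_def)
    from bounded_linear.has_vector_derivative[OF bounded_linear_vec_nth this]
    show ?thesis by (simp add: has_real_derivative_iff_has_vector_derivative)
  qed
  have eq: "(\<omega> $ i - (\<Sum>j\<in>UNIV. P $ i $ j * sin (\<theta> s $ i - \<theta> s $ j + \<phi> $ i $ j))) / D $ i = \<theta>' s $ i"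
    if "0 \<le> s" for s
  proof -
    have "D $ i * \<theta>' s $ i
        = \<omega> $ i - (\<Sum>j\<in>UNIV. P $ i $ j * sin (\<theta> s $ i - \<theta> s $ j + \<phi> $ i $ j))"
      using sol that by (simp add: kuramoto_solution_def)
    then show ?thesis using D by (metis less_irrefl nonzero_mult_div_cancel_left)
  qed
  have "((\<lambda>s. (\<omega> $ i - (\<Sum>j\<in>UNIV. P $ i $ j * sin (\<theta> s $ i - \<theta> s $ j + \<phi> $ i $ j))) / D $ i)
    has_real_derivative
    (0 - (\<Sum>j\<in>UNIV. P $ i $ j * (cos (\<theta> t $ i - \<theta> t $ j + \<phi> $ i $ j) * (\<theta>' t $ i - \<theta>' t $ j)))) / D $ i)
    (at t within {0..})"
    by (intro DERIV_cdivide DERIV_diff DERIV_const DERIV_sum DERIV_cmult)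
       (auto intro!: derivative_eq_intros d)
  also have "(0 - (\<Sum>j\<in>UNIV. P $ i $ j * (cos (\<theta> t $ i - \<theta> t $ j + \<phi> $ i $ j) * (\<theta>' t $ i - \<theta>' t $ j)))) / D $ i
    = (\<Sum>j\<in>UNIV. P $ i $ j * cos (\<theta> t $ i - \<theta> t $ j + \<phi> $ i $ j) / D $ i * (\<theta>' t $ j - \<theta>' t $ i))"
    by (simp add: sum_negf[symmetric] sum_divide_distrib minus_divide_left right_diff_distrib
        diff_divide_distrib
        mult.assoc)
  finally show ?thesis
    by (rule has_field_derivative_transform_within[OF _ zero_less_one]) (use eq t in auto)
qed

text \<open>
  Where each cosine is at least \<open>\<kappa>\<close>, no edge weight drops below the least \<open>\<kappa> P\<^sub>i\<^sub>j / D\<^sub>i\<close> over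
  the finitely many edges; \<open>c\<close> is this number, capped at 1. For \<open>K\<close>, each cosine is at most 1.
\<close>
lemma kuramoto_consensus_flow:
  fixes D \<omega> :: "real^'n" and P \<phi> :: "real^'n^'n"
  assumes D: "\<And>i. D $ i > 0" and P: "\<And>i j. P $ i $ j \<ge> 0"
    and sol: "kuramoto_solution D \<omega> P \<phi> \<theta> \<theta>'"
    and \<kappa>: "0 < \<kappa>" and cos: "\<And>t i j. 0 \<le> t \<Longrightarrow> \<kappa> \<le> cos (\<theta> t $ i - \<theta> t $ j + \<phi> $ i $ j)"
  obtains a c K where "consensus_flow (\<lambda>t i. \<theta>' t $ i) a (induced_edges P) c K"
proof -
  define a where "a t i j = P $ i $ j * cos (\<theta> t $ i - \<theta> t $ j + \<phi> $ i $ j) / D $ i" for t i j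
  define K where "K = (\<Sum>i\<in>UNIV. \<Sum>j\<in>UNIV. P $ i $ j / D $ i)"
  define c where "c = Min (insert 1 ((\<lambda>(i, j). \<kappa> * P $ i $ j / D $ i) ` induced_edges P))"
  have fin: "finite (insert 1 ((\<lambda>(i, j). \<kappa> * P $ i $ j / D $ i) ` induced_edges P))" by simp
  have "0 < c" unfolding c_def using \<kappa> D by (subst Min_gr_iff) (auto simp: induced_edges_def)
  moreover have "c \<le> 1" unfolding c_def by simp
  moreover have "c \<le> a t i j" if "0 \<le> t" "(i, j) \<in> induced_edges P" for t i j
  proof -
    have "c \<le> \<kappa> * P $ i $ j / D $ i" unfolding c_def using that by (intro Min_le[OF fin]) force
    also have "\<dots> \<le> a t i j"
      unfolding a_def using cos[OF that(1), of i j] P[of i j] D[of i]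
      by (intro divide_right_mono) (auto simp: mult.commute[of \<kappa>] intro: mult_left_mono)
    finally show ?thesis .
  qed
  moreover have "0 \<le> a t i j" if "0 \<le> t" for t i j
    unfolding a_def using cos[OF that, of i j] \<kappa> P[of i j] D[of i] by auto
  moreover have "(\<Sum>j\<in>UNIV. a t i j) \<le> K" if "0 \<le> t" for t i
  proof -
    have "(\<Sum>j\<in>UNIV. a t i j) \<le> (\<Sum>j\<in>UNIV. P $ i $ j / D $ i)"
      unfolding a_def using P D
      by (intro sum_mono divide_right_mono) (auto intro: mult_left_le less_imp_le)
    also have "\<dots> \<le> K"
      unfolding K_def using P D
      by (intro member_le_sum[of i UNIV "\<lambda>i. \<Sum>j\<in>UNIV. P $ i $ j / D $ i"])
        (auto intro!: sum_nonneg divide_nonneg_pos)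
    finally show ?thesis .
  qed
  ultimately have "consensus_flow (\<lambda>t i. \<theta>' t $ i) a (induced_edges P) c K"
    unfolding a_def using kuramoto_frequency_derivative[OF sol D] by unfold_locales auto
  then show ?thesis by (rule that)
qed

text \<open>
  The coupling matrix \<open>P\<^sub>i\<^sub>j sin (\<theta>\<^sub>i - \<theta>\<^sub>j)\<close> is antisymmetric, so its entries sum to zero.
\<close>
lemma weighted_frequency_sum:
  assumes sol: "kuramoto_solution D \<omega> P 0 \<theta> \<theta>'" and sym: "P = transpose P" and t: "0 \<le> t"
  shows "D \<bullet> \<theta>' t = (\<Sum>i\<in>UNIV. \<omega> $ i)"
proof -
  have P: "P $ i $ j = P $ j $ i" for i j using sym by (metis transpose_def vec_lambda_beta)
  let ?s = "\<lambda>i j. P $ i $ j * sin (\<theta> t $ i - \<theta> t $ j)"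
  have "D \<bullet> \<theta>' t = (\<Sum>i\<in>UNIV. \<omega> $ i) - (\<Sum>i\<in>UNIV. \<Sum>j\<in>UNIV. ?s i j)"
    using sol t by (simp add: inner_vec_def kuramoto_solution_def sum_subtractf)
  moreover have "(\<Sum>i\<in>UNIV. \<Sum>j\<in>UNIV. ?s i j) = - (\<Sum>i\<in>UNIV. \<Sum>j\<in>UNIV. ?s i j)"
  proof -
    have "?s i j = - ?s j i" for i j using sin_minus[of "\<theta> t $ i - \<theta> t $ j"] P[of i j] by simp
    then have "(\<Sum>i\<in>UNIV. \<Sum>j\<in>UNIV. ?s i j) = (\<Sum>i\<in>UNIV. \<Sum>j\<in>UNIV. - ?s j i)"
      by (intro sum.cong refl)
    also have "\<dots> = - (\<Sum>i\<in>UNIV. \<Sum>j\<in>UNIV. ?s i j)"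
      by (subst sum.swap) (simp add: sum_negf)
    finally show ?thesis .
  qed
  ultimately show ?thesis by simp
qed

text \<open>
  Multiplying \<open>x\<^sub>i'\<close> by \<open>D\<^sub>i\<close> makes the weights symmetric, which is why the energy is weighted by
  \<open>D\<close>: its derivative is minus a Dirichlet form, comparable to the form of the Laplacian of \<open>P\<close>
  because every cosine is at least \<open>cos \<gamma>\<close>.
\<close>
lemma frequency_energy_decay:
  fixes D \<omega> :: "real^'n" and P :: "real^'n^'n"
  assumes D: "\<And>i. D $ i > 0" and P: "\<And>i j. P $ i $ j \<ge> 0" and sym: "P = transpose P"
    and sol: "kuramoto_solution D \<omega> P 0 \<theta> \<theta>'"
    and \<gamma>: "0 \<le> cos \<gamma>" and cos: "\<And>t i j. 0 \<le> t \<Longrightarrow> cos \<gamma> \<le> cos (\<theta> t $ i - \<theta> t $ j)"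
    and mean: "\<And>t. 0 \<le> t \<Longrightarrow> D \<bullet> (\<theta>' t - \<nu> *\<^sub>R 1) = 0"
    and card: "CARD('n) \<ge> 2" and t: "0 \<le> t"
  defines "W \<equiv> \<lambda>t. \<Sum>i\<in>UNIV. D $ i * (\<theta>' t $ i - \<nu>)\<^sup>2"
  shows "W t \<le> W 0 * exp (2 * lambda_fe D P \<gamma> * t)"
proof (rule gronwall_decay[OF _ _ t])
  define w where "w t i j = P $ i $ j * cos (\<theta> t $ i - \<theta> t $ j)" for t i j
  define \<delta> where "\<delta> t = \<theta>' t - \<nu> *\<^sub>R 1" for t
  have P_sym: "P $ i $ j = P $ j $ i" for i j using sym by (metis transpose_def vec_lambda_beta)
  have w_sym: "w t i j = w t j i" for t i j
    using P_sym[of i j] cos_minus[of "\<theta> t $ i - \<theta> t $ j"] by (simp add: w_def)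
  define W' where "W' t = - (\<Sum>i\<in>UNIV. \<Sum>j\<in>UNIV. w t i j * (\<delta> t $ i - \<delta> t $ j)\<^sup>2)" for t
  show "(W has_real_derivative W' t) (at t within {0..})" if t: "0 \<le> t" for t
  proof -
    let ?d = "\<lambda>i. \<Sum>j\<in>UNIV. P $ i $ j * cos (\<theta> t $ i - \<theta> t $ j + 0 $ i $ j) / D $ i
      * (\<theta>' t $ j - \<theta>' t $ i)"
    have "(W has_real_derivative (\<Sum>i\<in>UNIV. D $ i * (2 * (\<theta>' t $ i - \<nu>) * ?d i))) (at t within {0..})"
      unfolding W_def
      by (intro DERIV_sum DERIV_cmult)
        (auto intro!: derivative_eq_intros kuramoto_frequency_derivative[OF sol D t])
    also have "(\<Sum>i\<in>UNIV. D $ i * (2 * (\<theta>' t $ i - \<nu>) * ?d i))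
        = (\<Sum>i\<in>UNIV. - 2 * (\<delta> t $ i * (\<Sum>j\<in>UNIV. w t i j * (\<delta> t $ i - \<delta> t $ j))))"
    proof (rule sum.cong[OF refl])
      fix i
      have "D $ i * ?d i = - (\<Sum>j\<in>UNIV. w t i j * (\<delta> t $ i - \<delta> t $ j))"
        using D[of i] by (simp add: sum_distrib_left sum_negf[symmetric] w_def \<delta>_def right_diff_distrib)
      then show "D $ i * (2 * (\<theta>' t $ i - \<nu>) * ?d i)
          = - 2 * (\<delta> t $ i * (\<Sum>j\<in>UNIV. w t i j * (\<delta> t $ i - \<delta> t $ j)))"
        by (simp add: \<delta>_def mult.assoc mult.left_commute[of "D $ i"])
    qed
    also have "\<dots> = W' t"
      using dirichlet_form[of "w t" "\<lambda>i. \<delta> t $ i", OF w_sym]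
      by (simp add: W'_def sum_distrib_left[symmetric] sum_negf)
    finally show ?thesis .
  qed
  show "W' t \<le> 2 * lambda_fe D P \<gamma> * W t" if t: "0 \<le> t" for t
  proof -
    let ?g = "lambda2 (laplacian P) * (cos (vec_angle D 1))\<^sup>2 / vec_max D"
    have "diag_matrix D *v 1 = D"
      by (simp add: vec_eq_iff diag_matrix_def matrix_vector_mult_def)
    then have rate: "lambda_fe D P \<gamma> = - (cos \<gamma> * ?g)" by (simp add: lambda_fe_def)
    have "W t = (\<Sum>i\<in>UNIV. D $ i * (\<delta> t $ i)\<^sup>2)" by (simp add: W_def \<delta>_def)
    then have "?g * W t \<le> \<delta> t \<bullet> (laplacian P *v \<delta> t)"
      using laplacian_gap_weighted_mean_zero[OF D P sym card, of "\<delta> t"] mean[OF t]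
      by (simp add: \<delta>_def)
    then have "cos \<gamma> * (2 * (?g * W t)) \<le> cos \<gamma> * (2 * (\<delta> t \<bullet> (laplacian P *v \<delta> t)))"
      using \<gamma> by (intro mult_left_mono) auto
    also have "\<dots> = (\<Sum>i\<in>UNIV. \<Sum>j\<in>UNIV. cos \<gamma> * (P $ i $ j * (\<delta> t $ i - \<delta> t $ j)\<^sup>2))"
      unfolding laplacian_form[OF sym] by (simp add: sum_distrib_left[symmetric])
    also have "\<dots> \<le> (\<Sum>i\<in>UNIV. \<Sum>j\<in>UNIV. w t i j * (\<delta> t $ i - \<delta> t $ j)\<^sup>2)"
    proof (intro sum_mono)
      fix i j
      have "cos \<gamma> * (P $ i $ j * (\<delta> t $ i - \<delta> t $ j)\<^sup>2)
          \<le> cos (\<theta> t $ i - \<theta> t $ j) * (P $ i $ j * (\<delta> t $ i - \<delta> t $ j)\<^sup>2)"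
        using cos[OF t] P by (intro mult_right_mono) auto
      then show "cos \<gamma> * (P $ i $ j * (\<delta> t $ i - \<delta> t $ j)\<^sup>2) \<le> w t i j * (\<delta> t $ i - \<delta> t $ j)\<^sup>2"
        by (simp add: w_def mult_ac)
    qed
    finally show ?thesis by (simp add: W'_def rate algebra_simps)
  qed
qed

text \<open>
  A single oscillator is treated apart, since \<open>\<lambda>\<^sub>2\<close> is then unspecified; its frequency equals
  \<open>\<nu>\<close> at all times.
\<close>
lemma frequency_norm_decay:
  fixes D \<omega> :: "real^'n" and P :: "real^'n^'n"
  assumes D: "\<And>i. D $ i > 0" and P: "\<And>i j. P $ i $ j \<ge> 0" and sym: "P = transpose P"
    and sol: "kuramoto_solution D \<omega> P 0 \<theta> \<theta>'"
    and \<gamma>: "0 \<le> cos \<gamma>" and cos: "\<And>t i j. 0 \<le> t \<Longrightarrow> cos \<gamma> \<le> cos (\<theta> t $ i - \<theta> t $ j)"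
    and mean: "\<And>t. 0 \<le> t \<Longrightarrow> D \<bullet> (\<theta>' t - \<nu> *\<^sub>R 1) = 0"
  shows "\<exists>C. \<forall>t\<ge>0. norm (\<theta>' t - \<nu> *\<^sub>R 1) \<le> C * exp (lambda_fe D P \<gamma> * t)"
proof (cases "CARD('n) \<ge> 2")
  case True
  define W where "W t = (\<Sum>i\<in>UNIV. D $ i * (\<theta>' t $ i - \<nu>)\<^sup>2)" for t
  define m where "m = Min (range (($) D))"
  have m: "0 < m" "\<And>i. m \<le> D $ i" using D by (auto simp: m_def)
  have norm: "m * (norm (\<theta>' t - \<nu> *\<^sub>R 1))\<^sup>2 \<le> W t" for t
  proof -
    have "m * (norm (\<theta>' t - \<nu> *\<^sub>R 1))\<^sup>2 = (\<Sum>i\<in>UNIV. m * (\<theta>' t $ i - \<nu>)\<^sup>2)"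
      by (simp add: power2_norm_eq_inner inner_vec_def power2_eq_square[of "_ $ _ - _"]
          sum_distrib_left)
    also have "\<dots> \<le> W t" unfolding W_def using m by (intro sum_mono mult_right_mono) auto
    finally show ?thesis .
  qed
  have "norm (\<theta>' t - \<nu> *\<^sub>R 1) \<le> sqrt (W 0 / m) * exp (lambda_fe D P \<gamma> * t)" if t: "0 \<le> t" for t
  proof (rule power2_le_imp_le)
    have W0: "0 \<le> W 0" unfolding W_def using D by (auto intro!: sum_nonneg simp: less_imp_le)
    have "m * (norm (\<theta>' t - \<nu> *\<^sub>R 1))\<^sup>2 \<le> W 0 * exp (2 * lambda_fe D P \<gamma> * t)"
      using norm[of t] frequency_energy_decay[OF D P sym sol \<gamma> cos mean True t]
      unfolding W_def by linarith
    then have "(norm (\<theta>' t - \<nu> *\<^sub>R 1))\<^sup>2 \<le> W 0 / m * exp (2 * lambda_fe D P \<gamma> * t)"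
      using m(1) by (simp add: field_simps)
    also have "\<dots> = (sqrt (W 0 / m) * exp (lambda_fe D P \<gamma> * t))\<^sup>2"
      using W0 m(1) by (simp add: power_mult_distrib exp_double[symmetric] mult.assoc)
    finally show "(norm (\<theta>' t - \<nu> *\<^sub>R 1))\<^sup>2 \<le> (sqrt (W 0 / m) * exp (lambda_fe D P \<gamma> * t))\<^sup>2" .
    show "0 \<le> sqrt (W 0 / m) * exp (lambda_fe D P \<gamma> * t)" using W0 m(1) by simp
  qed
  then show ?thesis by blast
next
  case False
  then have "CARD('n) = 1" using zero_less_card_finite[where 'a = 'n] by linarith
  then obtain k :: 'n where k: "UNIV = {k}" using card_1_singletonE by blast
  have "\<theta>' t - \<nu> *\<^sub>R 1 = 0" if "0 \<le> t" for t
  proof -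
    have "D $ k * (\<theta>' t - \<nu> *\<^sub>R 1) $ k = 0" using mean[OF that] unfolding inner_vec_def k by simp
    then have "(\<theta>' t - \<nu> *\<^sub>R 1) $ k = 0" using D[of k] by simp
    moreover have "i = k" for i using k by blast
    ultimately show ?thesis by (metis vec_eq_iff zero_index)
  qed
  then show ?thesis by (intro exI[of _ 0]) auto
qed

theorem theoremV1:
  fixes D \<omega> :: "real^'n"
    and P \<phi> :: "real^'n^'n"
    and \<gamma> :: real
    and \<theta> \<theta>' :: "real \<Rightarrow> real^'n"
  assumes "\<And>i. D $ i > 0"
    and "\<And>i j. P $ i $ j \<ge> 0"
    and "\<And>i. P $ i $ i = 0"
    and "\<And>i j. \<phi> $ i $ j = \<phi> $ j $ i"
    and "\<And>i j. 0 \<le> \<phi> $ i $ j \<and> \<phi> $ i $ j < pi / 2"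
    and "\<And>i. \<phi> $ i $ i = 0"
    and "\<exists>k. globally_reachable P k"
    and "0 \<le> \<gamma>" and "\<gamma> < pi / 2 - mat_max \<phi>"
    and "positively_invariant D \<omega> P \<phi> (Delta_bar \<gamma>)"
    and "kuramoto_solution D \<omega> P \<phi> \<theta> \<theta>'"
    and "to_torus (\<theta> 0) \<in> Delta_bar \<gamma>"
  shows "\<exists>\<nu>. vec_min (\<theta>' 0) \<le> \<nu> \<and> \<nu> \<le> vec_max (\<theta>' 0) \<and>
           (\<forall>i. converges_exponentially (\<lambda>t. \<theta>' t $ i) \<nu>) \<and>
           (mat_max \<phi> = 0 \<and> P = transpose P \<longrightarrow>
              \<nu> = (\<Sum>i\<in>UNIV. \<omega> $ i) / (\<Sum>i\<in>UNIV. D $ i) \<and>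
              (\<exists>C. \<forall>t\<ge>0. norm (\<theta>' t - \<nu> *\<^sub>R 1) \<le> C * exp (lambda_fe D P \<gamma> * t)))"
proof -
  note D = assms(1) and P = assms(2) and \<phi> = assms(5) and sol = assms(11)
  have p: "0 \<le> mat_max \<phi>" using \<phi> mat_max_ge order_trans by blast
  have \<gamma>: "0 < cos \<gamma>" "0 < cos (\<gamma> + mat_max \<phi>)"
    using assms(8,9) p by (auto intro!: cos_gt_zero_pi)
  have \<gamma>_pi: "\<gamma> + mat_max \<phi> \<le> pi" "\<gamma> \<le> pi" using assms(9) p pi_gt_zero by linarith+
  have diff: "cos \<gamma> \<le> cos (\<theta> t $ i - \<theta> t $ j)" if "0 \<le> t" for t i j
  proof -
    have "to_torus (\<theta> t) \<in> Delta_bar \<gamma>"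
      using assms(10) sol assms(12) that unfolding positively_invariant_def by blast
    then show ?thesis using \<gamma>_pi(2) by (rule Delta_bar_phase_differences)
  qed
  have "cos (\<gamma> + mat_max \<phi>) \<le> cos (\<theta> t $ i - \<theta> t $ j + \<phi> $ i $ j)" if "0 \<le> t" for t i j
    using \<phi> by (intro cos_phase_shift_lower_bound[OF diff[OF that] assms(8) _ mat_max_ge \<gamma>_pi(1)]) auto
  then obtain a c K where flow: "consensus_flow (\<lambda>t i. \<theta>' t $ i) a (induced_edges P) c K"
    using kuramoto_consensus_flow[OF D P sol \<gamma>(2)] by blast
  obtain k where "\<And>i. (i, k) \<in> (induced_edges P)\<^sup>*"
    using assms(7) by (auto simp: globally_reachable_def)
  then obtain \<nu> where \<nu>: "vec_min (\<theta>' 0) \<le> \<nu>" "\<nu> \<le> vec_max (\<theta>' 0)"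
    and conv: "\<And>i. converges_exponentially (\<lambda>t. \<theta>' t $ i) \<nu>"
    using consensus_flow.exponential_consensus[OF flow]
    unfolding consensus_flow.lo_def[OF flow] consensus_flow.hi_def[OF flow] vec_min_def vec_max_def
    by blast
  have "\<nu> = (\<Sum>i\<in>UNIV. \<omega> $ i) / (\<Sum>i\<in>UNIV. D $ i) \<and>
      (\<exists>C. \<forall>t\<ge>0. norm (\<theta>' t - \<nu> *\<^sub>R 1) \<le> C * exp (lambda_fe D P \<gamma> * t))"
    if special: "mat_max \<phi> = 0" "P = transpose P"
  proof -
    have "\<phi> = 0" using \<phi> mat_max_ge[of \<phi>] special(1) by (simp add: vec_eq_iff order_antisym)
    then have sol0: "kuramoto_solution D \<omega> P 0 \<theta> \<theta>'" using sol by simp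
    note total = weighted_frequency_sum[OF sol0 special(2)]
    have "((\<lambda>t. D \<bullet> \<theta>' t) \<longlongrightarrow> (\<Sum>i\<in>UNIV. D $ i * \<nu>)) at_top"
      unfolding inner_vec_def inner_real_def
      by (intro tendsto_sum tendsto_mult tendsto_const converges_exponentially_imp_tendsto conv)
    moreover have "((\<lambda>t. D \<bullet> \<theta>' t) \<longlongrightarrow> (\<Sum>i\<in>UNIV. \<omega> $ i)) at_top"
      by (intro tendsto_eventually eventually_mono[OF eventually_ge_at_top[of 0]] total)
    ultimately have lim: "(\<Sum>i\<in>UNIV. D $ i) * \<nu> = (\<Sum>i\<in>UNIV. \<omega> $ i)"
      using tendsto_unique[OF trivial_limit_at_top_linorder] by (metis sum_distrib_right)
    have "0 < (\<Sum>i\<in>UNIV. D $ i)" using D by (intro sum_pos) auto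
    then have "\<nu> = (\<Sum>i\<in>UNIV. \<omega> $ i) / (\<Sum>i\<in>UNIV. D $ i)" using lim by (simp add: field_simps)
    moreover have "D \<bullet> (\<theta>' t - \<nu> *\<^sub>R 1) = 0" if "0 \<le> t" for t
      using total[OF that] lim
      by (simp add: inner_diff_right inner_vec_def[of D 1] mult.commute)
    then have "\<exists>C. \<forall>t\<ge>0. norm (\<theta>' t - \<nu> *\<^sub>R 1) \<le> C * exp (lambda_fe D P \<gamma> * t)"
      using \<gamma>(1) diff by (intro frequency_norm_decay[OF D P special(2) sol0]) auto
    ultimately show ?thesis by blast
  qed
  then show ?thesis using \<nu> conv by blast
qed

end
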